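(* Let $\mathfrak g$ be of type $B_n^{(1)}$. Then $$\Sigma^{\Lambda_0}_{\Lambda_1}(q)=\frac{1}{2q^{\frac12}}\left(\frac{1}{(q^{\frac12})_\infty\,(q)_\infty^{\,n-1}\,(q^2)_\infty}-\frac{(q^{\frac12})_\infty}{(q)_\infty^{\,n+2}}\right).$$
   Context: **Type.** $\mathfrak g$ of type $B_n^{(1)}$ ($n\ge3$), colors $0,\dots,n$, $\delta=\alpha_0+\alpha_1+2(\alpha_2+\cdots+\alpha_n)$, $\ell=2n$. **Proper Young walls on $Y_{\Lambda_0}$.** There are infinitely many columns, numbered $1,2,\dots$ from right to left. Each column is a stack of unit-height floors. A floor is a unit cube of the indicated color, or a split floor $\{0,1\}$ made of two half-thickness blocks of colors $0,1$ in two positions A and B, or a floor $[n]$ made of two half-height $n$-blocks one on top of the other. The floors from bottom to top are, repeated cyclically: $\{0,1\},2,\dots,n-1,[n],n-1,\dots,2$. On a floor $\{0,1\}$ of column $k$, position A has color $1$ for $k$ odd and $0$ for $k$ even; B has the other color. The ground state wall $Y_{\Lambda_0}$ consists of the A-block of the bottom floor in every column. A Young wall $Y=(y_k)_{k\ge1}$ is obtained by adding finitely many blocks, where a floor may be started only when the floor below it is completely filled, the two blocks of a split floor above the bottom may be added in either order, and there is no free space to the right of any block (if a place is occupied in column $k+1$, the same place is occupied in column $k$). $|y_k|$ is the number of added blocks in column $k$. A column is full if its top floor is completely filled, i.e. $n\nmid|y_k|$; $Y$ is proper if no two full columns have the same height. Equivalently, a proper Young wall is a partition $(|y_k|)_k$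 whose parts not divisible by $n$ are distinct, with a choice A or B for each positive part divisible by $\ell$ (position of the top half-thickness block), equal parts having equal choices. $\mathcal Z(\Lambda_0)$ is the set of proper Young walls; $\mathrm{cont}(Y)=\sum_ik_i\alpha_i$ with $k_i$ the number of added $i$-blocks, $\mathrm{wt}(Y)=\Lambda_0-\mathrm{cont}(Y)$. The maximal weight $\Lambda_1$ is normalized as $\Lambda_1=\Lambda_0-\gamma$, $\gamma=\alpha_0+\alpha_2+\alpha_3+\cdots+\alpha_n$, so $\mathcal Z(\Lambda_0)_{\Lambda_1-m\delta}=\{Y\in\mathcal Z(\Lambda_0):\mathrm{cont}(Y)=\gamma+m\delta\}$. The string function is $\Sigma^{\Lambda_0}_{\Lambda_1}(q)=\sum_{m\ge0}|\mathcal Z(\Lambda_0)_{\Lambda_1-m\delta}|\,q^m$. $(q^a)_\infty=\prod_{m\ge1}(1-q^{am})$; the identity is one of formal series in $q^{1/2}$. *)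

theory Defs
  imports
    "HOL-Analysis.Infinite_Products"
    "HOL-Computational_Algebra.Formal_Laurent_Series"
begin

text \<open>
  Young walls of type \<open>B\<^sub>n\<^sup>(\<^sup>1\<^sup>)\<close> on the ground state wall of weight \<open>\<Lambda>\<^sub>0\<close>.  A wall is the set of
  its occupied places \<open>(k, f, s)\<close>: column \<open>k \<ge> 1\<close> (counted from right to left), floor
  \<open>f \<ge> 0\<close> (counted from the bottom), and slot \<open>s\<close> on that floor.
\<close>

datatype slot = Cube | PosA | PosB | Lower | Upper

type_synonym place = "nat \<times> nat \<times> slot"

text \<open>
  The cycle \<open>{0,1}, 2, \<dots>, n-1, [n], n-1, \<dots>, 2\<close> has \<open>2n - 2\<close> floors; the split floor is number
  \<open>0\<close> and the floor \<open>[n]\<close> is number \<open>n - 1\<close> in it.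
\<close>

definition slots :: "nat \<Rightarrow> nat \<Rightarrow> slot set" where
  "slots n f =
    (let r = f mod (2 * n - 2) in
      if r = 0 then {PosA, PosB}
      else if r = n - 1 then {Lower, Upper}
      else {Cube})"

fun block_color :: "nat \<Rightarrow> place \<Rightarrow> nat" where
  "block_color n (k, f, s) =
    (let r = f mod (2 * n - 2) in
      if r = 0 then (if s = PosA then (if odd k then 1 else 0) else (if odd k then 0 else 1))
      else if r \<le> n - 1 then r + 1
      else 2 * n - 1 - r)"

definition places :: "nat \<Rightarrow> place set" where
  "places n = {(k, f, s). k \<ge> 1 \<and> s \<in> slots n f}"

definition ground_wall :: "place set" where
  "ground_wall = {(k, f, s). k \<ge> 1 \<and> f = 0 \<and> s = PosA}"

definition floor_filled :: "nat \<Rightarrow> place set \<Rightarrow> nat \<Rightarrow> nat \<Rightarrow> bool" where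
  "floor_filled n Y k f \<longleftrightarrow> (\<forall>s \<in> slots n f. (k, f, s) \<in> Y)"

definition young_wall :: "nat \<Rightarrow> place set \<Rightarrow> bool" where
  "young_wall n Y \<longleftrightarrow>
     Y \<subseteq> places n \<and> ground_wall \<subseteq> Y \<and> finite (Y - ground_wall) \<and>
     (\<forall>k f s. (k, Suc f, s) \<in> Y \<longrightarrow> floor_filled n Y k f) \<and>
     (\<forall>k f. (k, f, Upper) \<in> Y \<longrightarrow> (k, f, Lower) \<in> Y) \<and>
     (\<forall>k f s. k \<ge> 1 \<and> (Suc k, f, s) \<in> Y \<longrightarrow> (k, f, s) \<in> Y)"

definition top_floor :: "place set \<Rightarrow> nat \<Rightarrow> nat" where
  "top_floor Y k = Max {f. \<exists>s. (k, f, s) \<in> Y}"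

definition full_column :: "nat \<Rightarrow> place set \<Rightarrow> nat \<Rightarrow> bool" where
  "full_column n Y k \<longleftrightarrow> floor_filled n Y k (top_floor Y k)"

text \<open>Floors have unit height, so full columns have equal heights iff their top floors agree.\<close>

definition proper_wall :: "nat \<Rightarrow> place set \<Rightarrow> bool" where
  "proper_wall n Y \<longleftrightarrow>
     young_wall n Y \<and>
     (\<forall>j \<ge> 1. \<forall>k \<ge> 1. j \<noteq> k \<and> full_column n Y j \<and> full_column n Y k \<longrightarrow>
        top_floor Y j \<noteq> top_floor Y k)"

text \<open>
  An element \<open>\<Sum>\<^sub>i c\<^sub>i \<alpha>\<^sub>i\<close> of the positive root lattice is represented by its coefficient function
  \<open>i \<mapsto> c\<^sub>i\<close>, which is zero for \<open>i > n\<close>.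
\<close>

definition cont :: "nat \<Rightarrow> place set \<Rightarrow> nat \<Rightarrow> nat" where
  "cont n Y i = card {p \<in> Y - ground_wall. block_color n p = i}"

text \<open>\<open>\<delta> = \<alpha>\<^sub>0 + \<alpha>\<^sub>1 + 2(\<alpha>\<^sub>2 + \<dots> + \<alpha>\<^sub>n)\<close>\<close>

definition delta :: "nat \<Rightarrow> nat \<Rightarrow> nat" where
  "delta n i = (if i \<le> 1 then 1 else if i \<le> n then 2 else 0)"

text \<open>\<open>\<gamma> = \<Lambda>\<^sub>0 - \<Lambda>\<^sub>1 = \<alpha>\<^sub>0 + \<alpha>\<^sub>2 + \<alpha>\<^sub>3 + \<dots> + \<alpha>\<^sub>n\<close>\<close>

definition gamma :: "nat \<Rightarrow> nat \<Rightarrow> nat" where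
  "gamma n i = (if i \<noteq> 1 \<and> i \<le> n then 1 else 0)"

text \<open>The walls of weight \<open>\<Lambda>\<^sub>1 - m \<delta>\<close>, i.e. of content \<open>\<gamma> + m \<delta>\<close>.\<close>

definition Z_Lambda1 :: "nat \<Rightarrow> nat \<Rightarrow> place set set" where
  "Z_Lambda1 n m = {Y. proper_wall n Y \<and> (\<forall>i. cont n Y i = gamma n i + m * delta n i)}"

definition string_function :: "nat \<Rightarrow> rat fps" where
  "string_function n = Abs_fps (\<lambda>m. of_nat (card (Z_Lambda1 n m)))"

text \<open>
  Formal series in \<open>q\<^sup>1\<^sup>/\<^sup>2\<close> are Laurent series in \<open>X = q\<^sup>1\<^sup>/\<^sup>2\<close>.  Thus \<open>(q\<^sup>a)\<^sub>\<infinity>\<close> is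
  \<open>qfac (2a) = \<Prod>\<^sub>m\<^sub>\<ge>\<^sub>1 (1 - X\<^sup>2\<^sup>a\<^sup>m)\<close>; the infinite product is taken in the \<open>X\<close>-adic topology of
  the formal power series.
\<close>

definition qfac :: "nat \<Rightarrow> rat fls" where
  "qfac k = fps_to_fls (\<Prod>m. 1 - fps_X ^ (k * Suc m))"

end

theory Submission
  imports Defs
begin

text \<open>
  The added blocks of a column are laid one after the other, except that a split floor \<open>{0,1}\<close>
  above the bottom may receive either of its two blocks first.  A proper wall is therefore a
  partition in which the parts not divisible by \<open>n\<close> are distinct, together with one binary choice
  for each size \<open>2nj\<close> (\<open>j \<ge> 1\<close>) that occurs as a part.  It is encoded by a function \<open>h\<close> on the
  part sizes: \<open>\<bar>h b\<bar>\<close> is the multiplicity of \<open>b\<close>, and for \<open>b = 2nj\<close> the sign of \<open>h b\<close> carries the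
  choice (\<open>bij_betw_wall_of\<close>, \<open>bij_betw_profile_of_parts\<close>).

  The difference of the numbers of blocks of two consecutive colors \<open>i, i + 1\<close> (with \<open>0\<close> and \<open>1\<close>
  counted together for \<open>i = 1\<close>) is the number of parts congruent to \<open>i\<close> minus the number of parts
  congruent to \<open>-i\<close> modulo \<open>2n\<close>.  The colors \<open>0\<close> and \<open>1\<close> alternate with the parity of the column.  So
  the parts equal to \<open>2nj\<close> contribute equally to both when their multiplicity is even, and leave one
  block in excess when it is odd.  The decisive point is to let the sign of \<open>h (2nj)\<close> be the
  \<^emph>\<open>color\<close> of the first block in excess and not its position A or B: then the position of the run
  in the wall no longer matters, and all conditions on the content become conditions on \<open>h\<close>
  that decouple.  They are (\<open>content_iff\<close>): for \<open>1 \<le> i < n\<close> there are as many parts congruent to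
  \<open>i\<close> as to \<open>-i\<close>; the sum of the signs over the odd multiplicities of the sizes \<open>2nj\<close>, the
  charge, is \<open>0\<close> or \<open>-1\<close>; and there are \<open>2m + 1\<close> blocks of color \<open>n\<close>.

  Let \<open>X\<close> mark the blocks of color \<open>n\<close>, and put \<open>q = X\<^sup>2\<close>.  Each \<open>i\<close> with \<open>1 \<le> i < n\<close> contributes
  pairs of equinumerous finite sets, which are the Frobenius coordinates of a partition, with
  generating function \<open>1/(q)\<^sub>\<infinity>\<close> (\<open>has_gf_balanced_pairs\<close>).  The odd multiples of \<open>n\<close> are
  unrestricted and contribute \<open>1/\<Prod>(1 - X\<^bsup>2j+1\<^esup>)\<close>.  For the sizes \<open>2nj\<close>, the factorization
  \<open>(1 + zx)(1 + x/z)/(1 - x\<^sup>2)\<close> of the generating function of a single signed multiplicity leads back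
  to balanced pairs and gives \<open>1/((q)\<^sub>\<infinity>(q\<^sup>2)\<^sub>\<infinity>)\<close> (\<open>has_gf_signed_mults\<close>).  The product of these series is
  \<open>F(X) = 1/((X)\<^sub>\<infinity>(q)\<^sub>\<infinity>\<^bsup>n-1\<^esup>(q\<^sup>2)\<^sub>\<infinity>)\<close>, the first term of the formula.  The walls of content \<open>\<gamma> + m\<delta>\<close> are
  counted by the coefficient of \<open>X\<^bsup>2m+1\<^esup>\<close>, so the string function at \<open>X\<^sup>2\<close> is \<open>(F(X) - F(-X))/(2X)\<close>.
  Finally \<open>F(-X)\<close> is the second term, because \<open>\<Prod>(1 - X\<^bsup>2j+1\<^esup>)(1 + X\<^bsup>2j+1\<^esup>) = (q)\<^sub>\<infinity>/(q\<^sup>2)\<^sub>\<infinity>\<close>.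
\<close>

unbundle no vec_syntax

section \<open>Generating functions of weighted sets\<close>

text \<open>Finiteness of the fibres is part of the notion: the cardinality of an infinite set is \<open>0\<close>, and
  without it the product rule would fail.\<close>

definition has_gf :: "'a set \<Rightarrow> ('a \<Rightarrow> nat) \<Rightarrow> rat fps \<Rightarrow> bool" where
  "has_gf D w F \<longleftrightarrow>
     (\<forall>m. finite {d \<in> D. w d = m} \<and> fps_nth F m = of_nat (card {d \<in> D. w d = m}))"

lemma has_gf_bij:
  assumes "bij_betw \<phi> A B" "\<And>a. a \<in> A \<Longrightarrow> v (\<phi> a) = w a" "has_gf A w F"
  shows "has_gf B v F"
proof -
  have eq: "{b \<in> B. v b = m} = \<phi> ` {a \<in> A. w a = m}" for m
    using assms(1,2) by (auto simp: bij_betw_def)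
  have "inj_on \<phi> {a \<in> A. w a = m}" for m
    using assms(1) by (auto simp: bij_betw_def inj_on_def)
  then show ?thesis
    using assms(3) by (simp add: has_gf_def eq card_image)
qed

lemma has_gf_times:
  assumes A: "has_gf A v F" and B: "has_gf B w G"
  shows "has_gf (A \<times> B) (\<lambda>(a, b). v a + w b) (F * G)"
proof -
  have eq: "{d \<in> A \<times> B. (case d of (a, b) \<Rightarrow> v a + w b) = m} =
      (\<Union>i\<in>{0..m}. {a \<in> A. v a = i} \<times> {b \<in> B. w b = m - i})" for m
    by auto
  have fin: "finite ({a \<in> A. v a = i} \<times> {b \<in> B. w b = m - i})" for i m
    using A B by (auto simp: has_gf_def)
  have "card (\<Union>i\<in>{0..m}. {a \<in> A. v a = i} \<times> {b \<in> B. w b = m - i}) =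
      (\<Sum>i=0..m. card {a \<in> A. v a = i} * card {b \<in> B. w b = m - i})" for m
    by (subst card_UN_disjoint) (use fin in \<open>auto simp: card_cartesian_product\<close>)
  then show ?thesis
    unfolding has_gf_def eq using fin A B by (simp add: fps_mult_nth has_gf_def)
qed

lemma has_gf_power:
  assumes "finite I" and D: "has_gf D w F"
  shows "has_gf (I \<rightarrow>\<^sub>E D) (\<lambda>f. \<Sum>i\<in>I. w (f i)) (F ^ card I)"
  using assms(1)
proof (induction I rule: finite_induct)
  case empty
  show ?case
    by (auto simp: has_gf_def fps_one_nth)
next
  case (insert i I)
  have "bij_betw (\<lambda>(y, g). g(i := y)) (D \<times> (I \<rightarrow>\<^sub>E D)) (insert i I \<rightarrow>\<^sub>E D)"
    unfolding bij_betw_def using inj_combinator[OF insert.hyps(2), of "\<lambda>_. D"]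
    by (simp add: PiE_insert_eq)
  moreover have "(\<Sum>k\<in>insert i I. w ((g(i := y)) k)) = w y + (\<Sum>k\<in>I. w (g k))" for y g
    using insert.hyps by (auto intro!: sum.cong)
  ultimately have "has_gf (insert i I \<rightarrow>\<^sub>E D) (\<lambda>f. \<Sum>i\<in>insert i I. w (f i)) (F * F ^ card I)"
    by (intro has_gf_bij[OF _ _ has_gf_times[OF D insert.IH]]) auto
  then show ?case
    using insert.hyps by simp
qed

lemma has_gf_finite:
  assumes "finite D"
  shows "has_gf D w (\<Sum>d\<in>D. fps_X ^ w d)"
proof -
  have "(\<Sum>d\<in>D. if m = w d then 1 else 0 :: rat) = of_nat (card {d \<in> D. w d = m})" for m
    using assms by (simp add: sum.If_cases) (rule arg_cong[of _ _ card], auto)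
  then show ?thesis
    using assms by (simp add: has_gf_def fps_sum_nth)
qed

lemma has_gf_multiples:
  assumes "c > 0"
  shows "has_gf UNIV (\<lambda>k. c * k) (inverse (1 - fps_X ^ c))"
proof -
  define F where "F = Abs_fps (\<lambda>m. if c dvd m then 1 else 0 :: rat)"
  have fib: "{k \<in> UNIV. c * k = m} = (if c dvd m then {m div c} else {})" for m
    using assms by (auto simp: dvd_def)
  have "F * (1 - fps_X ^ c) = 1"
    by (rule fps_ext)
      (use assms in \<open>auto simp: F_def right_diff_distrib fps_X_power_mult_right_nth dvd_minus_self dest: dvd_imp_le\<close>)
  then have F: "F = inverse (1 - fps_X ^ c)"
    by (metis fps_inverse_unique mult.commute)
  then show ?thesis
    unfolding has_gf_def fib F[symmetric] by (auto simp: F_def)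
qed

section \<open>Limits of formal power series and Euler products\<close>

lemma fps_tendsto_mult:
  fixes F G :: "'a::ring_1 fps"
  assumes "f \<longlonglongrightarrow> F" "g \<longlonglongrightarrow> G"
  shows "(\<lambda>n. f n * g n) \<longlonglongrightarrow> F * G"
proof (rule tendsto_fpsI)
  fix m
  have "eventually (\<lambda>n. \<forall>i\<in>{..m}. f n $ i = F $ i \<and> g n $ i = G $ i) sequentially"
    using assms by (intro eventually_ball_finite) (auto simp: tendsto_fps_iff intro: eventually_conj)
  then show "eventually (\<lambda>n. (f n * g n) $ m = (F * G) $ m) sequentially"
    by eventually_elim (auto simp: fps_mult_nth intro!: sum.cong)
qed

text \<open>Infinite families are handled by truncation.  If the \<open>N\<close>-th truncation contains the same objects
  of weight less than \<open>N\<close>, each coefficient of the truncated series is eventually constant.  Identities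
  between finite products then pass to the limit.\<close>

lemma has_gf_limit:
  assumes gf: "\<And>N. has_gf (D N) w (F N)"
    and eq: "\<And>N m. m < N \<Longrightarrow> {d \<in> E. w d = m} = {d \<in> D N. w d = m}"
  obtains G where "has_gf E w G" "F \<longlonglongrightarrow> G"
proof
  let ?G = "Abs_fps (\<lambda>m. of_nat (card {d \<in> E. w d = m}))"
  have "finite {d \<in> E. w d = m}" for m
    using gf[of "Suc m"] eq[of m "Suc m"] by (auto simp: has_gf_def)
  then show "has_gf E w ?G"
    by (simp add: has_gf_def)
  show "F \<longlonglongrightarrow> ?G"
  proof (rule tendsto_fpsI)
    fix m
    show "eventually (\<lambda>N. F N $ m = ?G $ m) sequentially"
      using eventually_gt_at_top[of m]
    proof eventually_elim
      case (elim N)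
      then show ?case
        using gf[of N] eq[OF elim] by (simp add: has_gf_def)
    qed
  qed
qed

definition euler :: "(nat \<Rightarrow> nat) \<Rightarrow> rat fps" where
  "euler c = (\<Prod>j. 1 - fps_X ^ c j)"

text \<open>Since \<open>c j > j\<close>, the factor with index \<open>j\<close> does not affect the coefficients up to \<open>j\<close>, so the partial
  products stabilize; the constant coefficient \<open>1\<close> shows that the limit is not zero, as convergence of
  an infinite product requires.\<close>

lemma euler_tendsto:
  assumes c: "\<And>j. c j > j"
  shows "(\<lambda>N. \<Prod>j<N. 1 - fps_X ^ c j) \<longlonglongrightarrow> euler c" and "euler c $ 0 = 1"
proof -
  let ?P = "\<lambda>N. \<Prod>j<N. 1 - fps_X ^ c j :: rat fps"
  define L where "L = Abs_fps (\<lambda>m. ?P (Suc m) $ m)"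
  have step: "?P (Suc m + k) $ m = ?P (Suc m) $ m" for m k
  proof (induction k)
    case (Suc k)
    have "m < c (Suc (m + k))"
      using c[of "Suc (m + k)"] by simp
    then show ?case
      using Suc by (simp add: right_diff_distrib fps_X_power_mult_right_nth)
  qed simp
  have lim: "?P \<longlonglongrightarrow> L"
  proof (rule tendsto_fpsI)
    fix m
    show "eventually (\<lambda>N. ?P N $ m = L $ m) sequentially"
      using eventually_ge_at_top[of "Suc m"]
    proof eventually_elim
      case (elim N)
      then show ?case
        using step[of m "N - Suc m"] by (simp add: L_def del: prod.lessThan_Suc)
    qed
  qed
  have L0: "L $ 0 = 1"
    using c[of 0] by (simp add: L_def)
  have "(\<lambda>N. \<Prod>j\<le>N. 1 - fps_X ^ c j) \<longlonglongrightarrow> L"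
    using LIMSEQ_Suc[OF lim] by (simp only: lessThan_Suc_atMost)
  moreover have "L \<noteq> 0"
    using L0 by auto
  ultimately have "(\<lambda>j. 1 - fps_X ^ c j) has_prod L"
    by (simp add: has_prod_def raw_has_prod_def)
  then have "L = euler c"
    unfolding euler_def by (rule has_prod_unique)
  then show "?P \<longlonglongrightarrow> euler c" "euler c $ 0 = 1"
    using lim L0 by auto
qed

section \<open>Multiplicity functions\<close>

definition mults :: "(nat \<Rightarrow> nat) set" where
  "mults = {f. finite {j. f j \<noteq> 0}}"

definition mult_weight :: "(nat \<Rightarrow> nat) \<Rightarrow> (nat \<Rightarrow> nat) \<Rightarrow> nat" where
  "mult_weight c f = (\<Sum>j | f j \<noteq> 0. c j * f j)"

lemma mult_weight_eq:
  assumes "finite A" "\<And>j. j \<notin> A \<Longrightarrow> f j = 0"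
  shows "mult_weight c f = (\<Sum>j\<in>A. c j * f j)"
  unfolding mult_weight_def
proof (rule sum.mono_neutral_left)
  show "{j. f j \<noteq> 0} \<subseteq> A"
    by (metis (mono_tags) assms(2) mem_Collect_eq subsetI)
qed (simp_all add: assms(1))

text \<open>Truncation at \<open>N\<close> leaves finitely many independent multiplicities, and each of them contributes a
  geometric series.\<close>

lemma has_gf_mults:
  assumes c: "\<And>j. c j > j"
  obtains G where "has_gf mults (mult_weight c) G" "G * euler c = 1"
proof -
  define D where "D N = {f :: nat \<Rightarrow> nat. \<forall>j\<ge>N. f j = 0}" for N :: nat
  let ?P = "\<lambda>N. \<Prod>j<N. 1 - fps_X ^ c j :: rat fps"
  have P: "?P N $ 0 = 1" for N
    using c by (induction N) (auto simp: gr0_conv_Suc dest: less_imp_Suc_add)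
  have gf: "has_gf (D N) (mult_weight c) (inverse (?P N))" for N
  proof (induction N)
    case 0
    have "D 0 = {\<lambda>_. 0}"
      by (auto simp: D_def)
    then have "has_gf (D 0) (mult_weight c) (fps_X ^ 0)"
      using has_gf_finite[of "D 0" "mult_weight c"] by (simp add: mult_weight_def)
    then show ?case
      by simp
  next
    case (Suc N)
    have bij: "bij_betw (\<lambda>(f, k). f(N := k)) (D N \<times> UNIV) (D (Suc N))"
      by (rule bij_betw_byWitness[where f' = "\<lambda>f. (f(N := 0), f N)"])
        (auto simp: D_def fun_eq_iff le_Suc_eq)
    have "mult_weight c (f(N := k)) = mult_weight c f + c N * k" if "f \<in> D N" for f k
    proof -
      have "mult_weight c (f(N := k)) = (\<Sum>j<Suc N. c j * (f(N := k)) j)"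
        using that by (intro mult_weight_eq) (auto simp: D_def)
      moreover have "mult_weight c f = (\<Sum>j<N. c j * f j)"
        using that by (intro mult_weight_eq) (auto simp: D_def)
      ultimately show ?thesis
        by simp
    qed
    moreover have "c N > 0"
      using c[of N] by simp
    ultimately have "has_gf (D (Suc N)) (mult_weight c) (inverse (?P N) * inverse (1 - fps_X ^ c N))"
      by (intro has_gf_bij[OF bij _ has_gf_times[OF Suc has_gf_multiples]]) auto
    then show ?case
      by (simp add: fps_inverse_mult)
  qed
  have fib: "{f \<in> mults. mult_weight c f = m} = {f \<in> D N. mult_weight c f = m}" if "m < N" for N m
  proof -
    have "f j = 0" if f: "f \<in> mults" and "mult_weight c f = m" "j \<ge> N" for f j
    proof (rule ccontr)
      assume "f j \<noteq> 0"
      then have "c j * f j \<le> mult_weight c f"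
        unfolding mult_weight_def using f by (intro member_le_sum) (auto simp: mults_def)
      moreover have "c j \<le> c j * f j"
        using \<open>f j \<noteq> 0\<close> by simp
      ultimately show False
        using c[of j] that \<open>m < N\<close> by linarith
    qed
    moreover have "D N \<subseteq> mults"
      by (auto simp: D_def mults_def intro!: finite_subset[of _ "{..<N}"]) (metis leI less_numeral_extra(3))
    ultimately show ?thesis
      by (auto simp: D_def)
  qed
  obtain G where G: "has_gf mults (mult_weight c) G" "(\<lambda>N. inverse (?P N)) \<longlonglongrightarrow> G"
    using has_gf_limit[of D "mult_weight c" "\<lambda>N. inverse (?P N)" mults, OF gf fib] by blast
  have "(\<lambda>N. inverse (?P N) * ?P N) \<longlonglongrightarrow> G * euler c"
    using G(2) euler_tendsto[OF c] by (intro fps_tendsto_mult)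
  moreover have "inverse (?P N) * ?P N = 1" for N
    using P[of N] by (simp add: inverse_mult_eq_1)
  ultimately have "G * euler c = 1"
    using LIMSEQ_unique[OF _ tendsto_const] by fastforce
  with G show ?thesis
    by (intro that)
qed

section \<open>Balanced pairs of sets and the Gaussian binomial coefficients\<close>

text \<open>This is \<open>q\<^bsup>k(k-1)/2\<^esup>\<close> times the Gaussian binomial coefficient of \<open>m\<close> over \<open>k\<close>.\<close>

definition subset_gf :: "'a::comm_ring_1 \<Rightarrow> nat \<Rightarrow> nat \<Rightarrow> 'a" where
  "subset_gf q m k = (\<Sum>U | U \<subseteq> {..<m} \<and> card U = k. q ^ \<Sum>U)"

lemma subset_gf_Suc:
  "subset_gf q (Suc m) (Suc k) = subset_gf q m (Suc k) + q ^ m * subset_gf q m k"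
proof -
  let ?A = "{U. U \<subseteq> {..<m} \<and> card U = Suc k}" and ?B = "{U. U \<subseteq> {..<m} \<and> card U = k}"
  have fin: "finite U" if "U \<subseteq> {..<m}" for U
    using that finite_subset by blast
  have "{U. U \<subseteq> {..<Suc m} \<and> card U = Suc k} = ?A \<union> insert m ` ?B" (is "?C = _")
  proof (intro equalityI subsetI)
    fix U assume U: "U \<in> ?C"
    show "U \<in> ?A \<union> insert m ` ?B"
    proof (cases "m \<in> U")
      case True
      then have "U - {m} \<in> ?B" "U = insert m (U - {m})"
        using U by (auto simp: lessThan_Suc)
      then show ?thesis
        by blast
    next
      case False
      then show ?thesis
        using U by (auto simp: lessThan_Suc)
    qed
  next
    fix U assume "U \<in> ?A \<union> insert m ` ?B"
    then show "U \<in> ?C"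
      using fin by (auto simp: lessThan_Suc card_insert_if)
  qed
  then have "subset_gf q (Suc m) (Suc k) = (\<Sum>U\<in>?A \<union> insert m ` ?B. q ^ \<Sum>U)"
    by (simp only: subset_gf_def)
  also have "\<dots> = (\<Sum>U\<in>?A. q ^ \<Sum>U) + (\<Sum>U\<in>insert m ` ?B. q ^ \<Sum>U)"
  proof (rule sum.union_disjoint)
    show "finite ?A" "finite (insert m ` ?B)"
      by simp_all
    show "?A \<inter> insert m ` ?B = {}"
      by auto
  qed
  also have "(\<Sum>U\<in>insert m ` ?B. q ^ \<Sum>U) = (\<Sum>U\<in>?B. q ^ \<Sum>(insert m U))"
  proof (subst sum.reindex)
    show "inj_on (insert m) ?B"
    proof (rule inj_onI)
      fix U V assume "U \<in> ?B" "V \<in> ?B" and eq: "insert m U = insert m V"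
      then have "m \<notin> U" "m \<notin> V"
        by auto
      with eq show "U = V" by (simp add: insert_ident)
    qed
  qed (simp add: o_def)
  also have "\<dots> = (\<Sum>U\<in>?B. q ^ m * q ^ \<Sum>U)"
  proof (rule sum.cong)
    fix U assume U: "U \<in> ?B"
    then have "m \<notin> U" "finite U"
      using fin by auto
    then show "q ^ \<Sum>(insert m U) = q ^ m * q ^ \<Sum>U"
      by (simp add: power_add)
  qed simp
  finally show ?thesis
    by (simp only: subset_gf_def sum_distrib_left)
qed

text \<open>The closed form is stated without division so that it holds in every commutative ring.  Both terms
  of the Pascal recurrence are multiplied by the factors missing from their products; what remains is
  \<open>(1 - q\<^bsup>m-l\<^esup>) + q\<^bsup>m-l\<^esup> (1 - q\<^bsup>l+1\<^esup>) = 1 - q\<^bsup>m+1\<^esup>\<close>.\<close>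

lemma subset_gf_closed_form:
  fixes q :: "'a::comm_ring_1"
  assumes "k \<le> m"
  shows "subset_gf q m k * (\<Prod>j<k. 1 - q ^ Suc j) * (\<Prod>j<m - k. 1 - q ^ Suc j) =
    q ^ (k choose 2) * (\<Prod>j<m. 1 - q ^ Suc j)"
  using assms
proof (induction m arbitrary: k)
  case 0
  have "{U :: nat set. U = {} \<and> card U = 0} = {{}}"
    by auto
  then show ?case
    using 0 by (simp add: subset_gf_def numeral_2_eq_2)
next
  case (Suc m)
  have zero: "subset_gf q (Suc m) 0 = 1"
  proof -
    have "{U. U \<subseteq> {..<Suc m} \<and> card U = 0} = {{}}"
      by (auto dest: finite_subset)
    then show ?thesis
      by (simp add: subset_gf_def)
  qed
  show ?case
  proof (cases k)
    case 0
    then show ?thesis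
      using zero by (simp add: numeral_2_eq_2)
  next
    case (Suc l)
    let ?e = "\<lambda>k. \<Prod>j<k. 1 - q ^ Suc j"
    have ch: "q ^ (Suc l choose 2) = q ^ (l choose 2) * q ^ l"
      by (simp add: numeral_2_eq_2 power_add)
    have IH2: "subset_gf q m l * ?e l * ?e (m - l) = q ^ (l choose 2) * ?e m"
      using Suc.IH[of l] Suc.prems Suc by simp
    show ?thesis
    proof (cases "l = m")
      case True
      have "{U. U \<subseteq> {..<m} \<and> card U = Suc m} = {}"
        using card_mono[of "{..<m}"] by (metis (mono_tags, lifting) Collect_empty_eq Suc_n_not_le_n card_lessThan finite_lessThan)
      then have "subset_gf q m (Suc m) = 0"
        by (simp only: subset_gf_def sum.empty)
      then have "subset_gf q (Suc m) (Suc l) = q ^ m * subset_gf q m l"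
        using True by (simp add: subset_gf_Suc)
      then have "subset_gf q (Suc m) (Suc l) * ?e (Suc l) * ?e (Suc m - Suc l) =
          q ^ l * (1 - q ^ Suc m) * (subset_gf q m l * ?e l * ?e (m - l))"
        using True by (simp del: power_Suc add: mult_ac)
      then show ?thesis
        unfolding Suc ch IH2 by (simp del: power_Suc add: mult_ac)
    next
      case False
      then have lm: "Suc l \<le> m" "m - l = Suc (m - Suc l)"
        using Suc.prems Suc by auto
      have IH1: "subset_gf q m (Suc l) * ?e (Suc l) * ?e (m - Suc l) = q ^ (Suc l choose 2) * ?e m"
        using Suc.IH[OF lm(1)] .
      have qm: "q ^ m = q ^ l * q ^ (m - l)"
        using lm(1) by (simp del: power_Suc flip: power_add)
      have e1: "?e (Suc l) = ?e l * (1 - q ^ Suc l)"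
        by simp
      have e2: "?e (m - l) = ?e (m - Suc l) * (1 - q ^ (m - l))"
        by (simp only: lm(2) prod.lessThan_Suc)
      have expand: "(a + p * b) * (x * u) * (y * v) = a * (x * u) * y * v + p * u * (b * x * (y * v))"
        for a b p u v x y :: 'a
        by (simp add: algebra_simps)
      have "subset_gf q (Suc m) (Suc l) * ?e (Suc l) * ?e (m - l) =
          subset_gf q m (Suc l) * ?e (Suc l) * ?e (m - Suc l) * (1 - q ^ (m - l)) +
          q ^ m * (1 - q ^ Suc l) * (subset_gf q m l * ?e l * ?e (m - l))"
        unfolding subset_gf_Suc e1 e2 by (rule expand)
      also have "\<dots> = q ^ (Suc l choose 2) * ?e m * ((1 - q ^ (m - l)) + q ^ (m - l) * (1 - q ^ Suc l))"
        unfolding IH1 IH2 ch qm distrib_left by (simp only: mult_ac)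
      also have "(1 - q ^ (m - l)) + q ^ (m - l) * (1 - q ^ Suc l) = 1 - q ^ Suc m"
        using lm by (simp del: power_Suc add: right_diff_distrib flip: power_add)
      finally show ?thesis
        using Suc by (simp del: power_Suc add: mult.assoc)
    qed
  qed
qed

text \<open>Read in decreasing order, the elements of such a pair are the Frobenius coordinates (arm and leg
  lengths along the diagonal) of a partition, and \<open>pair_weight\<close> is the size of this partition.\<close>

definition balanced_pairs :: "(nat set \<times> nat set) set" where
  "balanced_pairs = {(S, T). finite S \<and> finite T \<and> card S = card T}"

definition pair_weight :: "nat set \<times> nat set \<Rightarrow> nat" where
  "pair_weight = (\<lambda>(S, T). \<Sum>S + \<Sum>T + card T)"

text \<open>A pair of subsets of \<open>{..<N}\<close> is a subset of \<open>{..<2 * N}\<close>: the first set occupies the upper half, the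
  complement of the second set, reflected, the lower half.  The sets have equal size exactly when the
  resulting subset has \<open>N\<close> elements.\<close>

lemma bounded_pairs_subsets:
  fixes q :: "'a::comm_ring_1"
  shows "(\<Sum>p | p \<in> balanced_pairs \<and> fst p \<subseteq> {..<N} \<and> snd p \<subseteq> {..<N}. q ^ pair_weight p) *
    q ^ (N choose 2) = subset_gf q (2 * N) N"
proof -
  let ?D = "{p. p \<in> balanced_pairs \<and> fst p \<subseteq> {..<N} \<and> snd p \<subseteq> {..<N}}"
  let ?E = "{U. U \<subseteq> {..<2 * N} \<and> card U = N}"
  \<comment> \<open>The halves of the subset: \<open>s\<close> is moved to \<open>N + s\<close>, and \<open>t\<close> to \<open>N - 1 - t\<close>.\<close>
  define hi where "hi S = (\<lambda>s. N + s) ` S" for S :: "nat set"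
  define lo where "lo T = (\<lambda>t. N - Suc t) ` T" for T :: "nat set"
  define \<phi> where "\<phi> p = hi (fst p) \<union> lo ({..<N} - snd p)" for p
  define \<psi> where "\<psi> U = ({s. N + s \<in> U}, {t. t < N \<and> N - Suc t \<notin> U})" for U
  have disj: "hi S \<inter> lo T = {}" if "N > 0" for S T
    using that by (auto simp: hi_def lo_def)
  have inj_lo: "inj_on (\<lambda>t. N - Suc t) T" if "T \<subseteq> {..<N}" for T
  proof (rule inj_onI)
    fix x y assume "x \<in> T" "y \<in> T" and eq: "N - Suc x = N - Suc y"
    then have "x < N" "y < N"
      using that by auto
    with eq show "x = y"
      by linarith
  qed
  have fin: "finite S" if "S \<subseteq> {..<N}" for S
    using that finite_subset by blast
  have card_lo: "card (lo T) = card T" if "T \<subseteq> {..<N}" for T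
    unfolding lo_def using inj_lo[OF that] by (rule card_image)
  have card_hi: "card (hi S) = card S" for S
    unfolding hi_def by (rule card_image) auto
  have img: "\<phi> p \<in> ?E" if "p \<in> ?D" for p
  proof -
    obtain S T where p: "p = (S, T)"
      by (cases p)
    with that have ST: "S \<subseteq> {..<N}" "T \<subseteq> {..<N}" "card S = card T"
      by (auto simp: balanced_pairs_def)
    have "card (\<phi> p) = card (hi S) + card (lo ({..<N} - T))"
      unfolding \<phi>_def p fst_conv snd_conv
    proof (rule card_Un_disjoint)
      show "finite (hi S)" "finite (lo ({..<N} - T))"
        using fin[OF ST(1)] by (simp_all add: hi_def lo_def)
      show "hi S \<inter> lo ({..<N} - T) = {}"
        by (auto simp: hi_def lo_def)
    qed
    also have "\<dots> = card T + (N - card T)"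
      using ST fin by (simp add: card_hi card_lo card_Diff_subset)
    also have "\<dots> = N"
      using card_mono[OF _ ST(2)] by simp
    finally show ?thesis
      using ST by (auto simp: \<phi>_def p hi_def lo_def)
  qed
  have inv1: "\<psi> (\<phi> p) = p" if "p \<in> ?D" for p
  proof -
    obtain S T where p: "p = (S, T)"
      by (cases p)
    with that have ST: "S \<subseteq> {..<N}" "T \<subseteq> {..<N}"
      by auto
    have "N + s \<in> \<phi> p \<longleftrightarrow> s \<in> S" for s
      by (auto simp: \<phi>_def p hi_def lo_def)
    moreover have "N - Suc t \<in> \<phi> p \<longleftrightarrow> t \<notin> T" if "t < N" for t
    proof
      assume "N - Suc t \<in> \<phi> p"
      then have "N - Suc t \<in> lo ({..<N} - T)"
        using that by (auto simp: \<phi>_def p hi_def)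
      then obtain t' where "t' < N" "t' \<notin> T" "N - Suc t = N - Suc t'"
        by (auto simp: lo_def)
      then have "t = t'"
        using that by linarith
      then show "t \<notin> T"
        using \<open>t' \<notin> T\<close> by simp
    qed (use that in \<open>auto simp: \<phi>_def p lo_def\<close>)
    ultimately show ?thesis
      using ST by (auto simp: \<psi>_def p)
  qed
  have inv2: "\<phi> (\<psi> U) = U" if "U \<in> ?E" for U
  proof (intro equalityI subsetI)
    fix u assume "u \<in> U"
    show "u \<in> \<phi> (\<psi> U)"
    proof (cases "u < N")
      case True
      then have "u = N - Suc (N - Suc u)" "N - Suc u < N"
        by auto
      with \<open>u \<in> U\<close> have "u \<in> lo ({..<N} - snd (\<psi> U))"
        unfolding lo_def by (intro image_eqI[of _ _ "N - Suc u"]) (auto simp: \<psi>_def)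
      then show ?thesis
        by (simp add: \<phi>_def)
    next
      case False
      then have "u = N + (u - N)"
        by simp
      with \<open>u \<in> U\<close> have "u \<in> hi (fst (\<psi> U))"
        unfolding hi_def by (intro image_eqI[of _ _ "u - N"]) (auto simp: \<psi>_def)
      then show ?thesis
        by (simp add: \<phi>_def)
    qed
  qed (auto simp: \<phi>_def \<psi>_def hi_def lo_def)
  have img2: "\<psi> U \<in> ?D" if U: "U \<in> ?E" for U
  proof -
    obtain S T where p: "\<psi> U = (S, T)"
      by (cases "\<psi> U")
    have T: "T \<subseteq> {..<N}"
      using p by (auto simp: \<psi>_def)
    have S: "S \<subseteq> {..<N}"
      using p U by (auto simp: \<psi>_def)
    have "N = card (\<phi> (\<psi> U))"
      using inv2[OF U] U by simp
    also have "\<dots> = card (hi S) + card (lo ({..<N} - T))"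
      unfolding \<phi>_def p fst_conv snd_conv
    proof (rule card_Un_disjoint)
      show "finite (hi S)" "finite (lo ({..<N} - T))"
        using fin[OF S] by (simp_all add: hi_def lo_def)
      show "hi S \<inter> lo ({..<N} - T) = {}"
        by (auto simp: hi_def lo_def)
    qed
    also have "\<dots> = card S + (N - card T)"
      using T fin by (simp add: card_hi card_lo card_Diff_subset)
    finally have "card S = card T"
      using card_mono[OF _ T] by simp
    then show ?thesis
      using S T fin by (simp add: p balanced_pairs_def)
  qed
  have bij: "bij_betw \<phi> ?D ?E"
    by (intro bij_betw_byWitness[where f' = \<psi>] ballI image_subsetI inv1 inv2 img img2)
  have sum_phi: "\<Sum>(\<phi> p) = pair_weight p + (N choose 2)" if "p \<in> ?D" for p
  proof -
    obtain S T where p: "p = (S, T)"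
      by (cases p)
    with that have ST: "S \<subseteq> {..<N}" "T \<subseteq> {..<N}" "card S = card T"
      by (auto simp: balanced_pairs_def)
    have "\<Sum>(\<phi> p) = \<Sum>(hi S) + \<Sum>(lo ({..<N} - T))"
      unfolding \<phi>_def p fst_conv snd_conv
    proof (rule sum.union_disjoint)
      show "finite (hi S)" "finite (lo ({..<N} - T))"
        using fin[OF ST(1)] by (simp_all add: hi_def lo_def)
      show "hi S \<inter> lo ({..<N} - T) = {}"
        by (auto simp: hi_def lo_def)
    qed
    also have "\<Sum>(hi S) = N * card T + \<Sum>S"
      using ST(3) by (simp add: hi_def sum.reindex sum.distrib)
    also have "\<Sum>(lo ({..<N} - T)) = (\<Sum>t\<in>{..<N} - T. N - Suc t)"
      unfolding lo_def by (subst sum.reindex) (auto intro: inj_lo)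
    finally have 1: "\<Sum>(\<phi> p) = N * card T + \<Sum>S + (\<Sum>t\<in>{..<N} - T. N - Suc t)" .
    have "(\<Sum>t\<in>{..<N} - T. N - Suc t) + (\<Sum>t\<in>T. N - Suc t) = (\<Sum>t<N. N - Suc t)"
      using sum.subset_diff[OF ST(2), of "\<lambda>t. N - Suc t"] by simp
    also have "\<dots> = (\<Sum>t<N. t)"
      by (rule sum.nat_diff_reindex)
    also have "\<dots> = (N choose 2)"
      by (induction N) (auto simp: numeral_2_eq_2)
    finally have 2: "(\<Sum>t\<in>{..<N} - T. N - Suc t) + (\<Sum>t\<in>T. N - Suc t) = (N choose 2)" .
    have "(\<Sum>t\<in>T. N - Suc t) + \<Sum>T + card T = (\<Sum>t\<in>T. (N - Suc t) + t + 1)"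
      by (simp only: sum.distrib card_eq_sum)
    also have "\<dots> = (\<Sum>t\<in>T. N)"
      using ST(2) by (intro sum.cong) auto
    finally have 3: "(\<Sum>t\<in>T. N - Suc t) + \<Sum>T + card T = N * card T"
      by simp
    show ?thesis
      using 1 2 3 by (simp add: pair_weight_def p)
  qed
  show ?thesis
    unfolding subset_gf_def sum.reindex_bij_betw[OF bij, symmetric] sum_distrib_right
    by (intro sum.cong) (simp_all add: sum_phi power_add)
qed

text \<open>The truncated series is \<open>(q)\<^bsub>2N\<^esub> / ((q)\<^bsub>N\<^esub> (q)\<^bsub>N\<^esub>)\<close> for \<open>q = X\<^sup>c\<close>, which tends to \<open>1/(q)\<^sub>\<infinity>\<close>.  This is the constant
  term in \<open>z\<close> of Jacobi's triple product.\<close>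

lemma has_gf_balanced_pairs:
  assumes c: "c > 0"
  obtains G where "has_gf balanced_pairs (\<lambda>p. c * pair_weight p) G"
    "G * euler (\<lambda>j. c * Suc j) = 1"
proof -
  define D where "D N = {p. p \<in> balanced_pairs \<and> fst p \<subseteq> {..<N} \<and> snd p \<subseteq> {..<N}}" for N
  define F where "F N = (\<Sum>p\<in>D N. fps_X ^ (c * pair_weight p) :: rat fps)" for N
  let ?Q = "euler (\<lambda>j. c * Suc j)"
  let ?P = "\<lambda>N. \<Prod>j<N. 1 - fps_X ^ (c * Suc j) :: rat fps"
  have cS: "c * Suc j > j" for j
    using c by (cases c) auto
  have "finite (D N)" for N
    by (rule finite_subset[of _ "Pow {..<N} \<times> Pow {..<N}"]) (auto simp: D_def)
  then have gf: "has_gf (D N) (\<lambda>p. c * pair_weight p) (F N)" for N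
    unfolding F_def by (rule has_gf_finite)
  have fib: "{p \<in> balanced_pairs. c * pair_weight p = m} = {p \<in> D N. c * pair_weight p = m}"
    if "m < N" for N m
  proof -
    have "S \<subseteq> {..<N} \<and> T \<subseteq> {..<N}"
      if p: "(S, T) \<in> balanced_pairs" and m: "c * pair_weight (S, T) = m" for S T
    proof -
      have "pair_weight (S, T) < N"
        using m \<open>m < N\<close> c by (cases c) auto
      then have "\<Sum>S < N" "\<Sum>T < N"
        by (auto simp: pair_weight_def)
      moreover have "x \<le> \<Sum>S" if "x \<in> S" for x
        using p that by (intro member_le_sum) (auto simp: balanced_pairs_def)
      moreover have "x \<le> \<Sum>T" if "x \<in> T" for x
        using p that by (intro member_le_sum) (auto simp: balanced_pairs_def)
      ultimately show ?thesis
        by (meson lessThan_iff order.strict_trans1 subsetI)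
    qed
    then have "p \<in> D N \<longleftrightarrow> p \<in> balanced_pairs" if "c * pair_weight p = m" for p
      unfolding D_def using that by (cases p) auto
    then show ?thesis
      by blast
  qed
  obtain G where G: "has_gf balanced_pairs (\<lambda>p. c * pair_weight p) G" "F \<longlonglongrightarrow> G"
    using has_gf_limit[of D "\<lambda>p. c * pair_weight p" F balanced_pairs, OF gf fib] by blast
  have fin: "F N * (?P N * ?P N) = ?P (2 * N)" for N
  proof -
    let ?q = "fps_X ^ c :: rat fps"
    have 1: "F N * ?q ^ (N choose 2) = subset_gf ?q (2 * N) N"
      using bounded_pairs_subsets[of ?q N] by (simp add: F_def D_def power_mult)
    have 2: "subset_gf ?q (2 * N) N * ?P N * ?P N = ?q ^ (N choose 2) * ?P (2 * N)"
      using subset_gf_closed_form[of N "2 * N" ?q] by (simp add: power_mult del: power_Suc mult_Suc_right)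
    have "?q ^ (N choose 2) * (F N * (?P N * ?P N)) = F N * ?q ^ (N choose 2) * ?P N * ?P N"
      by (simp only: mult_ac)
    also have "\<dots> = ?q ^ (N choose 2) * ?P (2 * N)"
      by (simp only: 1 2)
    finally have "?q ^ (N choose 2) * (F N * (?P N * ?P N)) = ?q ^ (N choose 2) * ?P (2 * N)" .
    then show ?thesis
      by (simp only: mult_cancel_left) simp
  qed
  have lim: "?P \<longlonglongrightarrow> ?Q"
    using cS by (rule euler_tendsto)
  have "(\<lambda>N. F N * (?P N * ?P N)) \<longlonglongrightarrow> G * (?Q * ?Q)"
    using G(2) lim by (intro fps_tendsto_mult)
  moreover have "(\<lambda>N. ?P (2 * N)) \<longlonglongrightarrow> ?Q"
    using LIMSEQ_subseq_LIMSEQ[OF lim, of "\<lambda>N. 2 * N"] by (simp add: strict_mono_def o_def)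
  ultimately have "G * (?Q * ?Q) = ?Q"
    unfolding fin by (rule LIMSEQ_unique)
  moreover have "?Q \<noteq> 0"
    using euler_tendsto(2)[of "\<lambda>j. c * Suc j", OF cS] by auto
  ultimately have "G * ?Q = 1"
    by (simp flip: mult.assoc)
  with G show ?thesis
    by (intro that)
qed

section \<open>Signed multiplicities of bounded charge\<close>

text \<open>For a signed multiplicity function of the sizes \<open>2nj\<close>, an odd multiplicity leaves one block of color
  \<open>1\<close> (positive sign) or \<open>0\<close> (negative sign) unmatched; the charge is the resulting imbalance.\<close>

definition charge :: "(nat \<Rightarrow> int) \<Rightarrow> int" where
  "charge v = (\<Sum>j | odd (v j). sgn (v j))"

definition signed_mults :: "(nat \<Rightarrow> int) set" where
  "signed_mults = {v. finite {j. v j \<noteq> 0} \<and> charge v \<in> {0, -1}}"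

text \<open>With \<open>x\<close> marking the absolute value and \<open>z\<close> the contribution to the charge, the integers have the
  generating function \<open>1 + (z + z\<^sup>-\<^sup>1)(x + x\<^sup>3 + \<dots>) + 2(x\<^sup>2 + x\<^sup>4 + \<dots>) = (1 + zx)(1 + z\<^sup>-\<^sup>1x)/(1 - x\<^sup>2)\<close>.  The
  functions \<open>up\<close>, \<open>dn\<close> and \<open>pairs_of\<close> read off an exponent from each of the three factors, and \<open>combine\<close>
  is the inverse.\<close>

definition up :: "int \<Rightarrow> bool" where
  "up x \<longleftrightarrow> (x < 0) \<noteq> odd x"

definition dn :: "int \<Rightarrow> bool" where
  "dn x \<longleftrightarrow> x < 0"

definition pairs_of :: "int \<Rightarrow> nat" where
  "pairs_of x = nat (if x < 0 then (- x - 1) div 2 else x div 2)"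

definition combine :: "bool \<Rightarrow> bool \<Rightarrow> nat \<Rightarrow> int" where
  "combine a b g = (if b then (if a then - 2 * (int g + 1) else - (2 * int g + 1))
     else if a then 2 * int g + 1 else 2 * int g)"

lemma combine_simps [simp]:
  "up (combine a b g) = a" "dn (combine a b g) = b" "pairs_of (combine a b g) = g"
  by (auto simp: combine_def up_def dn_def pairs_of_def)

lemma combine_split [simp]: "combine (up x) (dn x) (pairs_of x) = x"
  unfolding combine_def up_def dn_def pairs_of_def by (auto elim!: evenE oddE; presburger)

lemma combine_eq_0_iff [simp]: "combine a b g = 0 \<longleftrightarrow> \<not> a \<and> \<not> b \<and> g = 0"
  by (auto simp: combine_def)

lemma abs_split: "nat \<bar>x\<bar> = of_bool (up x) + of_bool (dn x) + 2 * pairs_of x"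
proof -
  have "int (nat \<bar>combine a b g\<bar>) = int (of_bool a + of_bool b + 2 * g)" for a b g
    by (auto simp: combine_def)
  then have "nat \<bar>combine a b g\<bar> = of_bool a + of_bool b + 2 * g" for a b g
    by (simp only: of_nat_eq_iff)
  from this[of "up x" "dn x" "pairs_of x"] show ?thesis
    by simp
qed

lemma sgn_split: "(if odd x then sgn x else 0) = of_bool (up x) - of_bool (dn x)"
  by (auto simp: up_def dn_def sgn_if)

lemma split_zero [simp]: "\<not> up 0" "\<not> dn 0" "pairs_of 0 = 0"
  by (auto simp: up_def dn_def pairs_of_def)

lemma finite_split:
  assumes "finite {j. v j \<noteq> (0 :: int)}"
  shows "finite {j. up (v j)}" "finite {j. dn (v j)}" "finite {j. pairs_of (v j) \<noteq> 0}"
  by (rule finite_subset[OF _ assms]; force)+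

text \<open>Only the factors \<open>(1 + zx)(1 + z\<^sup>-\<^sup>1x)\<close> contribute to the charge, so it is a difference of two cardinalities.\<close>

lemma charge_card:
  assumes fin: "finite {j. v j \<noteq> 0}"
  shows "charge v = int (card {j. up (v j)}) - int (card {j. dn (v j)})"
proof -
  let ?A = "{j. v j \<noteq> 0}"
  have "charge v = (\<Sum>j\<in>?A. if odd (v j) then sgn (v j) else 0)"
    unfolding charge_def by (rule sum.mono_neutral_cong_left[OF fin]) auto
  also have "\<dots> = (\<Sum>j\<in>?A. of_bool (up (v j))) - (\<Sum>j\<in>?A. of_bool (dn (v j)))"
    by (simp only: sgn_split sum_subtractf)
  also have "(\<Sum>j\<in>?A. of_bool (up (v j)) :: int) = int (card {j. up (v j)})"
    using fin by (simp add: sum.If_cases of_bool_def) (rule arg_cong[of _ _ card], force)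
  also have "(\<Sum>j\<in>?A. of_bool (dn (v j)) :: int) = int (card {j. dn (v j)})"
    using fin by (simp add: sum.If_cases of_bool_def) (rule arg_cong[of _ _ card], force)
  finally show ?thesis .
qed

lemma signed_weight_split:
  assumes fin: "finite {j. v j \<noteq> 0}"
  shows "mult_weight Suc (\<lambda>j. nat \<bar>v j\<bar>) =
    (\<Sum>j | up (v j). Suc j) + (\<Sum>j | dn (v j). Suc j) + 2 * mult_weight Suc (\<lambda>j. pairs_of (v j))"
proof -
  let ?A = "{j. v j \<noteq> 0}"
  have "mult_weight Suc (\<lambda>j. nat \<bar>v j\<bar>) = (\<Sum>j\<in>?A. Suc j * nat \<bar>v j\<bar>)"
    by (rule mult_weight_eq[OF fin]) auto
  also have "\<dots> = (\<Sum>j\<in>?A. of_bool (up (v j)) * Suc j) + (\<Sum>j\<in>?A. of_bool (dn (v j)) * Suc j)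
      + 2 * (\<Sum>j\<in>?A. Suc j * pairs_of (v j))"
    by (simp only: abs_split distrib_left sum.distrib sum_distrib_left mult_ac)
  also have "(\<Sum>j\<in>?A. of_bool (up (v j)) * Suc j) = (\<Sum>j | up (v j). Suc j)"
    by (rule sum.mono_neutral_cong_right[OF fin]) force+
  also have "(\<Sum>j\<in>?A. of_bool (dn (v j)) * Suc j) = (\<Sum>j | dn (v j). Suc j)"
    by (rule sum.mono_neutral_cong_right[OF fin]) force+
  also have "(\<Sum>j\<in>?A. Suc j * pairs_of (v j)) = mult_weight Suc (\<lambda>j. pairs_of (v j))"
    by (rule mult_weight_eq[OF fin, symmetric]) auto
  finally show ?thesis .
qed

text \<open>Membership of \<open>0\<close> changes the size of a set but not its sum.  This freedom is used to encode the charge.\<close>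

lemma nat_set_split_0:
  fixes S :: "nat set"
  assumes "finite S"
  shows "finite {j. Suc j \<in> S}" "card S = card {j. Suc j \<in> S} + of_bool (0 \<in> S)"
    "\<Sum>S = (\<Sum>j | Suc j \<in> S. Suc j)"
proof -
  let ?S = "{j. Suc j \<in> S}"
  have eq: "S = Suc ` ?S \<union> (if 0 \<in> S then {0} else {})"
    by (auto simp: image_iff split: if_splits) (metis not0_implies_Suc)+
  show fin: "finite ?S"
    using finite_vimageI[OF assms, of Suc] by (simp add: vimage_def)
  have "card S = card (Suc ` ?S) + card (if 0 \<in> S then {0 :: nat} else {})"
    by (subst eq, rule card_Un_disjoint) (use fin in auto)
  then show "card S = card ?S + of_bool (0 \<in> S)"
    by (simp add: card_image)
  have "\<Sum>S = \<Sum>(Suc ` ?S) + \<Sum>(if 0 \<in> S then {0 :: nat} else {})"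
    by (subst eq, rule sum.union_disjoint) (use fin in auto)
  then show "\<Sum>S = (\<Sum>j\<in>?S. Suc j)"
    by (simp add: sum.reindex)
qed

text \<open>Let \<open>U\<close> and \<open>T\<close> be the sets of the indices with \<open>up\<close> and with \<open>dn\<close>.  Charge \<open>0\<close> or \<open>-1\<close> means
  \<open>card T = card U\<close> or \<open>card T = card U + 1\<close>.  Shifting \<open>U\<close> by one and adding \<open>0\<close> in the second case yields
  a set of the same size as \<open>T\<close>.  So the two cases together correspond to all balanced pairs.\<close>

lemma has_gf_signed_mults:
  assumes c: "c > 0"
  obtains G where "has_gf signed_mults (\<lambda>v. c * mult_weight Suc (\<lambda>j. nat \<bar>v j\<bar>)) G"
    "G * (euler (\<lambda>j. c * Suc j) * euler (\<lambda>j. 2 * c * Suc j)) = 1"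
proof -
  obtain G1 where G1: "has_gf balanced_pairs (\<lambda>p. c * pair_weight p) G1"
      "G1 * euler (\<lambda>j. c * Suc j) = 1"
    using has_gf_balanced_pairs[OF c] .
  have "2 * c * Suc j > j" for j
    using c by (cases c) auto
  then obtain G2 where G2: "has_gf mults (mult_weight (\<lambda>j. 2 * c * Suc j)) G2"
      "G2 * euler (\<lambda>j. 2 * c * Suc j) = 1"
    using has_gf_mults[of "\<lambda>j. 2 * c * Suc j"] by blast
  \<comment> \<open>The first set is shifted by one; its element \<open>0\<close>, if present, stands for the charge \<open>-1\<close>.\<close>
  define \<phi> where "\<phi> = (\<lambda>((S, T), f) j. combine (Suc j \<in> S) (j \<in> T) (f j :: nat))"
  define \<psi> where "\<psi> v = ((Suc ` {j. up (v j)} \<union> (if charge v = -1 then {0} else {}), {j. dn (v j)}),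
      \<lambda>j. pairs_of (v j))" for v
  have fin: "finite {j. \<phi> ((S, T), f) j \<noteq> 0}"
    and charge_phi: "charge (\<phi> ((S, T), f)) = - of_bool (0 \<in> S)"
    and weight_phi: "mult_weight Suc (\<lambda>j. nat \<bar>\<phi> ((S, T), f) j\<bar>) =
      pair_weight (S, T) + 2 * mult_weight Suc f"
    if "(S, T) \<in> balanced_pairs" "f \<in> mults" for S T f
  proof -
    have ST: "finite S" "finite T" "card S = card T" "finite {j. f j \<noteq> 0}"
      using that by (auto simp: balanced_pairs_def mults_def)
    have "{j. \<phi> ((S, T), f) j \<noteq> 0} \<subseteq> {j. Suc j \<in> S} \<union> T \<union> {j. f j \<noteq> 0}"
      by (auto simp: \<phi>_def)
    then show fin: "finite {j. \<phi> ((S, T), f) j \<noteq> 0}"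
      by (rule finite_subset) (use nat_set_split_0(1)[OF ST(1)] ST in simp)
    show "charge (\<phi> ((S, T), f)) = - of_bool (0 \<in> S)"
      using charge_card[OF fin] nat_set_split_0(2)[OF ST(1)] ST(3) by (simp add: \<phi>_def)
    have "(\<Sum>j\<in>T. Suc j) = \<Sum>T + card T"
      by (induction T rule: infinite_finite_induct) auto
    then show "mult_weight Suc (\<lambda>j. nat \<bar>\<phi> ((S, T), f) j\<bar>) = pair_weight (S, T) + 2 * mult_weight Suc f"
      using signed_weight_split[OF fin] nat_set_split_0(3)[OF ST(1)]
      by (simp add: \<phi>_def pair_weight_def)
  qed
  have bij: "bij_betw \<phi> (balanced_pairs \<times> mults) signed_mults"
  proof (rule bij_betw_byWitness[where f' = \<psi>]; intro ballI image_subsetI)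
    fix x assume x: "x \<in> balanced_pairs \<times> mults"
    obtain S T f where eq: "x = ((S, T), f)"
      by (metis surj_pair)
    have st: "(S, T) \<in> balanced_pairs" "f \<in> mults"
      using x eq by auto
    have "Suc ` {j. Suc j \<in> S} \<union> (if 0 \<in> S then {0} else {}) = S"
      by (auto simp: image_iff split: if_splits) (metis not0_implies_Suc)+
    then show "\<psi> (\<phi> x) = x"
      unfolding eq \<psi>_def using charge_phi[OF st] by (simp add: \<phi>_def)
    show "\<phi> x \<in> signed_mults"
      unfolding eq signed_mults_def using fin[OF st] charge_phi[OF st] by simp
  next
    fix v assume "v \<in> signed_mults"
    then have v: "finite {j. v j \<noteq> 0}" "charge v = 0 \<or> charge v = -1"
      by (auto simp: signed_mults_def)
    show "\<phi> (\<psi> v) = v"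
      by (auto simp: \<phi>_def \<psi>_def image_iff)
    let ?S = "Suc ` {j. up (v j)} \<union> (if charge v = -1 then {0} else {})"
    have S: "finite ?S"
      using finite_split[OF v(1)] by simp
    have "card ?S = card {j. up (v j)} + of_bool (charge v = -1)"
      using nat_set_split_0(2)[OF S] by (simp add: image_iff)
    then have "card ?S = card {j. dn (v j)}"
      using charge_card[OF v(1)] v(2) by auto
    then show "\<psi> v \<in> balanced_pairs \<times> mults"
      using finite_split[OF v(1)] S by (simp add: \<psi>_def balanced_pairs_def mults_def)
  qed
  have scale: "mult_weight (\<lambda>j. 2 * c * Suc j) f = 2 * c * mult_weight Suc f" for f
    by (simp add: mult_weight_def sum_distrib_left mult_ac del: mult_Suc mult_Suc_right)
  have "has_gf signed_mults (\<lambda>v. c * mult_weight Suc (\<lambda>j. nat \<bar>v j\<bar>)) (G1 * G2)"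
    by (rule has_gf_bij[OF bij _ has_gf_times[OF G1(1) G2(1)]])
      (auto simp: weight_phi scale distrib_left simp del: mult_Suc mult_Suc_right)
  moreover have "G1 * G2 * (euler (\<lambda>j. c * Suc j) * euler (\<lambda>j. 2 * c * Suc j)) =
      (G1 * euler (\<lambda>j. c * Suc j)) * (G2 * euler (\<lambda>j. 2 * c * Suc j))"
    by (simp only: mult_ac)
  ultimately show ?thesis
    using G1(2) G2(2) by (intro that) (simp_all only: mult_1_left)
qed

section \<open>Walls as profiles\<close>

text \<open>The places of a column are numbered from the bottom, starting with \<open>0\<close> for the ground block.  There
  are \<open>n\<close> places on every \<open>n - 1\<close> consecutive floors, because exactly the floors divisible by \<open>n - 1\<close>
  have two slots; these are alternately split floors \<open>{0,1}\<close> and floors \<open>[n]\<close>.  On a split floor, A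
  precedes B.\<close>

definition level :: "nat \<Rightarrow> nat \<Rightarrow> slot \<Rightarrow> nat" where
  "level n f s = n * (f div (n - 1)) +
     (if f mod (n - 1) = 0 then of_bool (s = PosB \<or> s = Upper) else f mod (n - 1) + 1)"

definition floor_of :: "nat \<Rightarrow> nat \<Rightarrow> nat" where
  "floor_of n a = (n - 1) * (a div n) + (a mod n - 1)"

definition slot_of :: "nat \<Rightarrow> nat \<Rightarrow> slot" where
  "slot_of n a =
     (if a mod n = 0 then if even (a div n) then PosA else Lower
      else if a mod n = 1 then if even (a div n) then PosB else Upper
      else Cube)"

definition low :: "nat \<Rightarrow> nat \<Rightarrow> nat" where
  "low n f = n * (f div (n - 1)) + (if f mod (n - 1) = 0 then 0 else f mod (n - 1) + 1)"

definition high :: "nat \<Rightarrow> nat \<Rightarrow> nat" where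
  "high n f = n * (f div (n - 1)) + f mod (n - 1) + 1"

text \<open>For a wall in which \<open>R a\<close> columns occupy level \<open>a\<close>, and for \<open>a \<ge> 1\<close>, this is the number of columns
  with at least \<open>a\<close> added blocks.  The levels \<open>2nj\<close> and \<open>2nj + 1\<close> (positions A and B of one floor) may be
  filled in either order: the larger count belongs to the first block laid, the smaller one to the second.\<close>

definition reach :: "nat \<Rightarrow> (nat \<Rightarrow> nat) \<Rightarrow> nat \<Rightarrow> nat" where
  "reach n R a =
     (if a mod (2 * n) = 0 then max (R a) (R (Suc a))
      else if a mod (2 * n) = 1 then min (R (a - 1)) (R a)
      else R a)"

text \<open>Level \<open>0\<close> is occupied in every column, by the ground block.  The convention \<open>R 0 = R 1\<close> makes the bottom floor behave like the other split floors, with no column in which only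
  one of the two blocks is present.\<close>

definition profiles :: "nat \<Rightarrow> (nat \<Rightarrow> nat) set" where
  "profiles n = {R. R 0 = R 1 \<and> finite {a. R a \<noteq> 0} \<and> antimono (reach n R)}"

definition proper_profiles :: "nat \<Rightarrow> (nat \<Rightarrow> nat) set" where
  "proper_profiles n =
     {R \<in> profiles n. \<forall>a. \<not> n dvd a \<longrightarrow> reach n R a \<le> reach n R (Suc a) + 1}"

definition wall_of :: "nat \<Rightarrow> (nat \<Rightarrow> nat) \<Rightarrow> place set" where
  "wall_of n R = {(k, f, s). k \<ge> 1 \<and> s \<in> slots n f \<and> k \<le> R (level n f s)} \<union> ground_wall"

text \<open>The maximum implements the convention that the value at \<open>0\<close> equals the value at \<open>1\<close>.\<close>

definition profile_of :: "nat \<Rightarrow> place set \<Rightarrow> nat \<Rightarrow> nat" where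
  "profile_of n Y a =
     card {k. k \<ge> 1 \<and> (k, floor_of n (max 1 a), slot_of n (max 1 a)) \<in> Y}"

definition level_color :: "nat \<Rightarrow> nat \<Rightarrow> nat \<Rightarrow> nat" where
  "level_color n k a = block_color n (k, floor_of n a, slot_of n a)"

lemma mod_double:
  assumes "p > 0"
  shows "f mod (2 * p) = (if even (f div p) then f mod p else p + f mod (p :: nat))"
  by (subst mult.commute, subst mod_mult2_eq) (simp add: parity_cases even_iff_mod_2_eq_zero odd_iff_mod_2_eq_one)

context
  fixes n :: nat
  assumes n: "n \<ge> 3"
begin

lemma mod_pred_less: "f mod (n - 1) + 1 < n"
  using mod_less_divisor[of "n - 1" f] n by linarith

lemma slots_eq:
  "slots n f = (if f mod (n - 1) \<noteq> 0 then {Cube}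
     else if even (f div (n - 1)) then {PosA, PosB} else {Lower, Upper})"
proof -
  have "f mod (2 * n - 2) = (if even (f div (n - 1)) then f mod (n - 1) else n - 1 + f mod (n - 1))"
    using mod_double[of "n - 1" f] n by (simp add: right_diff_distrib')
  moreover have "f mod (n - 1) + 1 < n"
    by (rule mod_pred_less)
  ultimately show ?thesis
    using n by (auto simp: slots_def Let_def)
qed

lemma level_floor_of: "level n (floor_of n a) (slot_of n a) = a"
  and slot_of_in_slots: "slot_of n a \<in> slots n (floor_of n a)"
proof -
  have w: "a mod n - 1 < n - 1"
    using n mod_less_divisor[of n a] by linarith
  have fd: "floor_of n a div (n - 1) = a div n" "floor_of n a mod (n - 1) = a mod n - 1"
    unfolding floor_of_def using w by simp_all
  define q w where "q = a div n" and "w = a mod n"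
  have a: "a = n * q + w"
    by (simp add: q_def w_def)
  show "level n (floor_of n a) (slot_of n a) = a"
    unfolding level_def fd slot_of_def q_def[symmetric] w_def[symmetric]
    by (cases "w = 0"; cases "w = 1") (simp_all add: a)
  show "slot_of n a \<in> slots n (floor_of n a)"
    unfolding slots_eq fd by (auto simp: slot_of_def)
qed

lemma floor_of_level:
  assumes "s \<in> slots n f"
  shows "floor_of n (level n f s) = f" "slot_of n (level n f s) = s"
proof -
  let ?w = "if f mod (n - 1) = 0 then of_bool (s = PosB \<or> s = Upper) else f mod (n - 1) + 1"
  have "?w < n"
    using n mod_pred_less[of f] by simp
  then have d: "level n f s div n = f div (n - 1)" "level n f s mod n = ?w"
    unfolding level_def by simp_all
  have f: "f = (n - 1) * (f div (n - 1)) + f mod (n - 1)"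
    by simp
  show "floor_of n (level n f s) = f"
    unfolding floor_of_def d by (subst (4) f) auto
  show "slot_of n (level n f s) = s"
    unfolding slot_of_def d using assms by (auto simp: slots_eq split: if_splits)
qed

lemma level_eq_0_iff:
  assumes "s \<in> slots n f"
  shows "level n f s = 0 \<longleftrightarrow> f = 0 \<and> s = PosA"
  using floor_of_level[OF assms] assms n
  by (auto simp: floor_of_def slot_of_def level_def)

lemma level_mod:
  "level n f s mod (2 * n) = 0 \<longleftrightarrow> f mod (n - 1) = 0 \<and> even (f div (n - 1)) \<and> s \<noteq> PosB \<and> s \<noteq> Upper"
  "level n f s mod (2 * n) = 1 \<longleftrightarrow> f mod (n - 1) = 0 \<and> even (f div (n - 1)) \<and> (s = PosB \<or> s = Upper)"
proof -
  let ?w = "if f mod (n - 1) = 0 then of_bool (s = PosB \<or> s = Upper) else f mod (n - 1) + 1"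
  have "?w < n"
    using n mod_pred_less[of f] by simp
  then have d: "level n f s div n = f div (n - 1)" "level n f s mod n = ?w"
    unfolding level_def by simp_all
  show "level n f s mod (2 * n) = 0 \<longleftrightarrow> f mod (n - 1) = 0 \<and> even (f div (n - 1)) \<and> s \<noteq> PosB \<and> s \<noteq> Upper"
    using mod_double[of n "level n f s"] n unfolding d by auto
  show "level n f s mod (2 * n) = 1 \<longleftrightarrow> f mod (n - 1) = 0 \<and> even (f div (n - 1)) \<and> (s = PosB \<or> s = Upper)"
    using mod_double[of n "level n f s"] n unfolding d by auto
qed

lemma low_Suc: "low n (Suc f) = Suc (high n f)"
  using n by (auto simp: low_def high_def div_Suc mod_Suc algebra_simps)

lemma low_le_high: "low n f \<le> high n f"
  by (auto simp: low_def high_def)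

text \<open>This lemma and the next one say that the levels not divisible by \<open>n\<close> are exactly the last levels of the floors,
  that is, the numbers of added blocks for which a column is full.\<close>

lemma high_not_dvd: "\<not> n dvd high n f"
proof -
  have "high n f mod n = f mod (n - 1) + 1"
    unfolding high_def add.assoc using mod_pred_less[of f] by simp
  then show ?thesis
    by (simp add: dvd_eq_mod_eq_0)
qed

lemma not_dvd_imp_high:
  assumes "\<not> n dvd a"
  obtains f where "a = high n f"
proof
  have w1: "a mod n \<ge> 1"
    using assms by (simp add: dvd_eq_mod_eq_0 Suc_le_eq)
  then have w: "a mod n - 1 < n - 1"
    using n mod_less_divisor[of n a] by linarith
  have fd: "floor_of n a div (n - 1) = a div n" "floor_of n a mod (n - 1) = a mod n - 1"
    unfolding floor_of_def using w by simp_all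
  show "a = high n (floor_of n a)"
    unfolding high_def fd add.assoc le_add_diff_inverse2[OF w1] by simp
qed

text \<open>For a profile, the smallest and the largest of the counts of the slots of a floor are the values of
  \<open>reach\<close> at the last and at the first level of the floor (\<open>reach_bounds\<close>).  Hence a floor is filled in exactly \<open>reach n R (high n f)\<close> columns,
  and, above the bottom, occupied in exactly \<open>reach n R (low n f)\<close> columns.\<close>

lemma reach_high_attained: "\<exists>s\<in>slots n f. R (level n f s) = reach n R (high n f)"
  and reach_low_attained: "\<exists>s\<in>slots n f. R (level n f s) = reach n R (low n f)"
proof -
  consider (cube) "f mod (n - 1) \<noteq> 0"
    | (split) "f mod (n - 1) = 0" "even (f div (n - 1))"
    | (halves) "f mod (n - 1) = 0" "odd (f div (n - 1))"
    by blast
  then have "(\<exists>s\<in>slots n f. R (level n f s) = reach n R (high n f)) \<and>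
    (\<exists>s\<in>slots n f. R (level n f s) = reach n R (low n f))"
  proof cases
    case cube
    then have "low n f = level n f Cube" "high n f = level n f Cube"
      by (simp_all add: low_def high_def level_def)
    then show ?thesis
      using cube level_mod[of f Cube] by (simp add: slots_eq reach_def)
  next
    case split
    then have l: "low n f = level n f PosA" "high n f = level n f PosB" "level n f PosB = Suc (level n f PosA)"
      by (simp_all add: low_def high_def level_def)
    show ?thesis
      using split level_mod[of f PosA] level_mod[of f PosB]
      by (auto simp: slots_eq reach_def l min_def max_def)
  next
    case halves
    then have l: "low n f = level n f Lower" "high n f = level n f Upper"
      by (simp_all add: low_def high_def level_def)
    show ?thesis
      using halves level_mod[of f Lower] level_mod[of f Upper]
      by (simp add: slots_eq reach_def l)
  qed
  then show "\<exists>s\<in>slots n f. R (level n f s) = reach n R (high n f)"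
    "\<exists>s\<in>slots n f. R (level n f s) = reach n R (low n f)"
    by auto
qed

lemma reach_bounds:
  assumes "antimono (reach n R)" "s \<in> slots n f"
  shows "reach n R (high n f) \<le> R (level n f s)" "R (level n f s) \<le> reach n R (low n f)"
proof -
  consider (cube) "f mod (n - 1) \<noteq> 0"
    | (split) "f mod (n - 1) = 0" "even (f div (n - 1))"
    | (halves) "f mod (n - 1) = 0" "odd (f div (n - 1))"
    by blast
  then have "reach n R (high n f) \<le> R (level n f s) \<and> R (level n f s) \<le> reach n R (low n f)"
  proof cases
    case cube
    then have "low n f = level n f Cube" "high n f = level n f Cube"
      by (simp_all add: low_def high_def level_def)
    then show ?thesis
      using cube level_mod[of f Cube] assms(2) by (simp add: slots_eq reach_def)
  next
    case split
    then have l: "low n f = level n f PosA" "high n f = level n f PosB" "level n f PosB = Suc (level n f PosA)"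
      by (simp_all add: low_def high_def level_def)
    show ?thesis
      using split level_mod[of f PosA] level_mod[of f PosB] assms(2)
      by (auto simp: slots_eq reach_def l)
  next
    case halves
    then have l: "low n f = level n f Lower" "high n f = level n f Upper"
      by (simp_all add: low_def high_def level_def)
    have "reach n R (high n f) \<le> reach n R (low n f)"
      using assms(1) low_le_high by (rule antimonoD)
    then show ?thesis
      using halves level_mod[of f Lower] level_mod[of f Upper] assms(2)
      by (auto simp: slots_eq reach_def l)
  qed
  then show "reach n R (high n f) \<le> R (level n f s)" "R (level n f s) \<le> reach n R (low n f)"
    by auto
qed

lemma wall_of_iff:
  assumes "k \<ge> 1"
  shows "(k, f, s) \<in> wall_of n R \<longleftrightarrow> s \<in> slots n f \<and> (k \<le> R (level n f s) \<or> level n f s = 0)"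
proof -
  have "PosA \<in> slots n 0" "level n 0 PosA = 0"
    by (simp_all add: slots_eq level_def)
  with assms show ?thesis
    using level_eq_0_iff[of s f] by (auto simp: wall_of_def ground_wall_def)
qed

context
  fixes R assumes R: "R \<in> profiles n"
begin

lemma reach_antimono: "antimono (reach n R)"
  and R_0: "R 0 = R 1"
  and finite_support_R: "finite {a. R a \<noteq> 0}"
  using R by (auto simp: profiles_def)

lemma floor_filled_iff:
  assumes k: "k \<ge> 1"
  shows "floor_filled n (wall_of n R) k f \<longleftrightarrow> k \<le> reach n R (high n f)"
proof -
  have "floor_filled n (wall_of n R) k f \<longleftrightarrow> (\<forall>s\<in>slots n f. k \<le> R (level n f s) \<or> level n f s = 0)"
    by (auto simp: floor_filled_def wall_of_iff[OF k])
  also have "\<dots> \<longleftrightarrow> (\<forall>s\<in>slots n f. k \<le> R (level n f s))"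
  proof -
    have "k \<le> R 0" if "\<forall>s\<in>slots n 0. k \<le> R (level n 0 s) \<or> level n 0 s = 0"
    proof -
      have "PosB \<in> slots n 0" "level n 0 PosB = 1"
        by (simp_all add: slots_eq level_def)
      then show ?thesis
        using that R_0 by force
    qed
    then show ?thesis
      using level_eq_0_iff by metis
  qed
  also have "\<dots> \<longleftrightarrow> k \<le> reach n R (high n f)"
    using reach_high_attained[of f R] reach_bounds(1)[OF reach_antimono] by (metis order_trans)
  finally show ?thesis .
qed

lemma floor_occupied_iff:
  assumes k: "k \<ge> 1"
  shows "(\<exists>s. (k, f, s) \<in> wall_of n R) \<longleftrightarrow> f = 0 \<or> k \<le> reach n R (low n f)"
proof (cases "f = 0")
  case True
  then show ?thesis
    using k by (auto simp: wall_of_def ground_wall_def)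
next
  case False
  then have "(\<exists>s. (k, f, s) \<in> wall_of n R) \<longleftrightarrow> (\<exists>s\<in>slots n f. k \<le> R (level n f s))"
    using level_eq_0_iff by (auto simp: wall_of_iff[OF k])
  also have "\<dots> \<longleftrightarrow> k \<le> reach n R (low n f)"
    using reach_low_attained[of f R] reach_bounds(2)[OF reach_antimono] by (metis order_trans)
  finally show ?thesis
    using False by simp
qed

text \<open>The columns that are full with top floor \<open>f\<close> are those in which \<open>f\<close> is filled and the next floor is
  empty.  Properness thus bounds the drops of \<open>reach\<close> by \<open>1\<close> at all levels \<open>high n f\<close>.\<close>

lemma full_column_iff:
  assumes k: "k \<ge> 1"
  shows "full_column n (wall_of n R) k \<and> top_floor (wall_of n R) k = f \<longleftrightarrow>
    reach n R (Suc (high n f)) < k \<and> k \<le> reach n R (high n f)"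
proof -
  let ?A = "{f. \<exists>s. (k, f, s) \<in> wall_of n R}"
  have A: "f \<in> ?A \<longleftrightarrow> f = 0 \<or> k \<le> reach n R (low n f)" for f
    using floor_occupied_iff[OF k] by simp
  have low_mono: "low n f \<le> low n g" if "f \<le> g" for f g
    using that by (rule lift_Suc_mono_le[rotated]) (use low_Suc low_le_high in \<open>simp add: le_SucI\<close>)
  have down: "f \<in> ?A" if "g \<in> ?A" "f \<le> g" for f g
    using that low_mono[OF \<open>f \<le> g\<close>] reach_antimono unfolding A
    by (metis antimonoD le_zero_eq order_trans)
  have "?A \<subseteq> insert 0 ((floor_of n) ` {a. R a \<noteq> 0})"
  proof
    fix f assume "f \<in> ?A"
    then obtain s where "(k, f, s) \<in> wall_of n R"
      by blast
    then show "f \<in> insert 0 ((floor_of n) ` {a. R a \<noteq> 0})"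
      using k floor_of_level[of s f] level_eq_0_iff[of s f] wall_of_iff[OF k, of f s R]
      by (cases "f = 0") (auto intro!: image_eqI[of _ _ "level n f s"])
  qed
  then have fin: "finite ?A"
    by (rule finite_subset) (use finite_support_R in simp)
  have ne: "?A \<noteq> {}"
    using A[of 0] by blast
  have top: "top_floor (wall_of n R) k = f \<longleftrightarrow> f \<in> ?A \<and> Suc f \<notin> ?A" for f
  proof
    assume "top_floor (wall_of n R) k = f"
    then have "f = Max ?A"
      by (simp add: top_floor_def)
    then show "f \<in> ?A \<and> Suc f \<notin> ?A"
      using Max_in[OF fin ne] Max_ge[OF fin, of "Suc f"] by (metis Suc_n_not_le_n)
  next
    assume f: "f \<in> ?A \<and> Suc f \<notin> ?A"
    then have "g \<le> f" if "g \<in> ?A" for g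
      using down[OF that, of "Suc f"] by (metis not_less_eq_eq)
    then show "top_floor (wall_of n R) k = f"
      unfolding top_floor_def using f fin by (intro Max_eqI) auto
  qed
  have "full_column n (wall_of n R) k \<and> top_floor (wall_of n R) k = f \<longleftrightarrow>
      k \<le> reach n R (high n f) \<and> f \<in> ?A \<and> Suc f \<notin> ?A"
    using top[of f] floor_filled_iff[OF k, of f] by (auto simp: full_column_def)
  also have "\<dots> \<longleftrightarrow> k \<le> reach n R (high n f) \<and> \<not> k \<le> reach n R (low n (Suc f))"
    unfolding A using antimonoD[OF reach_antimono low_le_high[of f]] by auto
  finally show ?thesis
    by (auto simp: low_Suc)
qed

lemma young_wall_of: "young_wall n (wall_of n R)"
  unfolding young_wall_def
proof (intro conjI allI impI)
  show "wall_of n R \<subseteq> places n"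
    by (auto simp: wall_of_def places_def ground_wall_def slots_eq)
  show "ground_wall \<subseteq> wall_of n R"
    by (simp add: wall_of_def)
  have "wall_of n R - ground_wall \<subseteq>
      (\<Union>a\<in>{a. R a \<noteq> 0}. (\<lambda>k. (k, floor_of n a, slot_of n a)) ` {1..R a})"
  proof
    fix p assume p: "p \<in> wall_of n R - ground_wall"
    obtain k f s where eq: "p = (k, f, s)"
      by (metis surj_pair)
    with p have "k \<ge> 1" "s \<in> slots n f" "k \<le> R (level n f s)"
      by (auto simp: wall_of_def)
    then show "p \<in> (\<Union>a\<in>{a. R a \<noteq> 0}. (\<lambda>k. (k, floor_of n a, slot_of n a)) ` {1..R a})"
      unfolding eq using floor_of_level[of s f]
      by (intro UN_I[of "level n f s"] image_eqI[of _ _ k]) auto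
  qed
  then show "finite (wall_of n R - ground_wall)"
    by (rule finite_subset) (use finite_support_R in simp)
next
  fix k f s assume Y: "(k, Suc f, s) \<in> wall_of n R"
  then have k: "k \<ge> 1"
    by (auto simp: wall_of_def ground_wall_def)
  have "k \<le> reach n R (low n (Suc f))"
    using Y floor_occupied_iff[OF k, of "Suc f"] by auto
  also have "\<dots> \<le> reach n R (high n f)"
    using reach_antimono by (rule antimonoD) (simp add: low_Suc)
  finally show "floor_filled n (wall_of n R) k f"
    using floor_filled_iff[OF k] by simp
next
  fix k f assume Y: "(k, f, Upper) \<in> wall_of n R"
  then have k: "k \<ge> 1"
    by (auto simp: wall_of_def ground_wall_def)
  have f: "f mod (n - 1) = 0" "odd (f div (n - 1))" "k \<le> R (level n f Upper)"
    using Y by (auto simp: wall_of_iff[OF k] slots_eq level_def split: if_splits)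
  have l: "low n f = level n f Lower"
    using f by (simp_all add: low_def level_def)
  have "R (level n f Upper) \<le> reach n R (low n f)"
    using reach_bounds(2)[OF reach_antimono, of Upper f] f by (simp add: slots_eq)
  also have "\<dots> = R (level n f Lower)"
    unfolding l using level_mod[of f Lower] f by (simp add: reach_def)
  finally show "(k, f, Lower) \<in> wall_of n R"
    using f by (simp add: wall_of_iff[OF k] slots_eq)
next
  fix k f s assume "1 \<le> k \<and> (Suc k, f, s) \<in> wall_of n R"
  then show "(k, f, s) \<in> wall_of n R"
    by (auto simp: wall_of_def ground_wall_def)
qed

lemma proper_wall_of_iff:
  "proper_wall n (wall_of n R) \<longleftrightarrow> R \<in> proper_profiles n"
proof
  assume proper: "proper_wall n (wall_of n R)"
  have "reach n R a \<le> reach n R (Suc a) + 1" if a: "\<not> n dvd a" for a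
  proof (rule ccontr)
    assume neg: "\<not> ?thesis"
    obtain f where f: "a = high n f"
      using not_dvd_imp_high[OF a] .
    \<comment> \<open>A drop by at least \<open>2\<close> makes this column and the next one full with the same top floor.\<close>
    let ?k = "reach n R (Suc a) + 1"
    have "full_column n (wall_of n R) ?k \<and> top_floor (wall_of n R) ?k = f"
      "full_column n (wall_of n R) (Suc ?k) \<and> top_floor (wall_of n R) (Suc ?k) = f"
      using neg by (subst full_column_iff; simp add: f)+
    then show False
      using proper by (auto simp: proper_wall_def)
  qed
  then show "R \<in> proper_profiles n"
    using R by (simp add: proper_profiles_def)
next
  assume "R \<in> proper_profiles n"
  then have P: "reach n R (high n f) \<le> reach n R (Suc (high n f)) + 1" for f
    using high_not_dvd by (simp add: proper_profiles_def)
  show "proper_wall n (wall_of n R)"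
    unfolding proper_wall_def
  proof (intro conjI allI impI young_wall_of)
    fix j k assume jk: "1 \<le> j" "1 \<le> k"
      "j \<noteq> k \<and> full_column n (wall_of n R) j \<and> full_column n (wall_of n R) k"
    show "top_floor (wall_of n R) j \<noteq> top_floor (wall_of n R) k"
    proof
      assume eq: "top_floor (wall_of n R) j = top_floor (wall_of n R) k"
      let ?f = "top_floor (wall_of n R) k"
      have "reach n R (Suc (high n ?f)) < j" "j \<le> reach n R (high n ?f)"
        "reach n R (Suc (high n ?f)) < k" "k \<le> reach n R (high n ?f)"
        using full_column_iff[of j ?f] full_column_iff[of k ?f] jk eq by auto
      then show False
        using P[of ?f] jk by linarith
    qed
  qed
qed

lemma profile_of_wall_of: "profile_of n (wall_of n R) = R"
proof
  fix a :: nat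
  define b where "b = max 1 a"
  have "(k, floor_of n b, slot_of n b) \<in> wall_of n R \<longleftrightarrow> k \<le> R b" if "k \<ge> 1" for k
    unfolding wall_of_iff[OF that] level_floor_of using slot_of_in_slots by (simp add: b_def)
  then have "{k. k \<ge> 1 \<and> (k, floor_of n b, slot_of n b) \<in> wall_of n R} = {1..R b}"
    by auto
  then have "profile_of n (wall_of n R) a = R b"
    unfolding profile_of_def b_def[symmetric] by simp
  then show "profile_of n (wall_of n R) a = R a"
    using R_0 by (cases a) (auto simp: b_def)
qed

end

text \<open>Without free space to the right, the columns occupying a given place are an initial segment, so the
  counts determine the wall.\<close>

lemma young_wall_eq_wall_of:
  assumes Y: "young_wall n Y"
  shows "Y = wall_of n (profile_of n Y)" "profile_of n Y \<in> profiles n"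
proof -
  let ?R = "profile_of n Y"
  have pl: "Y \<subseteq> places n" and gr: "ground_wall \<subseteq> Y" and fin: "finite (Y - ground_wall)"
    and fl: "\<And>k f s. (k, Suc f, s) \<in> Y \<Longrightarrow> floor_filled n Y k f"
    and ul: "\<And>k f. (k, f, Upper) \<in> Y \<Longrightarrow> (k, f, Lower) \<in> Y"
    and rt: "\<And>k f s. k \<ge> 1 \<Longrightarrow> (Suc k, f, s) \<in> Y \<Longrightarrow> (k, f, s) \<in> Y"
    using Y unfolding young_wall_def by blast+
  have count: "{k. k \<ge> 1 \<and> (k, f, s) \<in> Y} = {1..?R (level n f s)}"
    if s: "s \<in> slots n f" and pos: "level n f s \<noteq> 0" for f s
  proof -
    let ?K = "{k. k \<ge> 1 \<and> (k, f, s) \<in> Y}"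
    have "(\<lambda>k. (k, f, s)) ` ?K \<subseteq> Y - ground_wall"
      using level_eq_0_iff[OF s] pos by (auto simp: ground_wall_def)
    then have "finite ((\<lambda>k. (k, f, s)) ` ?K)"
      using fin by (rule finite_subset)
    then have K: "finite ?K"
      by (rule finite_imageD) (auto intro: inj_onI)
    have down: "j \<in> ?K" if "k \<in> ?K" "1 \<le> j" "j \<le> k" for j k
      using that(3)
    proof (induction rule: inc_induct)
      case base
      then show ?case
        using that(1) .
    next
      case (step i)
      then show ?case
        using rt[of i] that(2) by simp
    qed
    have "?K = {1..card ?K}"
    proof (cases "?K = {}")
      case False
      obtain M where M: "?K = {1..M}"
      proof
        show "?K = {1..Max ?K}"
          using down[OF Max_in[OF K False]] Max_ge[OF K] by auto
      qed
      show ?thesis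
        unfolding M by simp
    next
      case True
      show ?thesis
        unfolding True by simp
    qed
    moreover have "?R (level n f s) = card ?K"
      using pos floor_of_level[OF s] by (simp add: profile_of_def max_def)
    ultimately show ?thesis
      by simp
  qed
  have in_Y: "(k, f, s) \<in> Y \<longleftrightarrow> k \<le> ?R (level n f s)"
    if "s \<in> slots n f" "level n f s \<noteq> 0" "k \<ge> 1" for k f s
  proof -
    have "k \<in> {k. k \<ge> 1 \<and> (k, f, s) \<in> Y} \<longleftrightarrow> k \<in> {1..?R (level n f s)}"
      by (simp only: count[OF that(1,2)])
    then show ?thesis
      using that(3) by simp
  qed
  have "(k, f, s) \<in> Y \<longleftrightarrow> (k, f, s) \<in> wall_of n ?R" for k f s
  proof (cases "k \<ge> 1 \<and> s \<in> slots n f")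
    case True
    show ?thesis
    proof (cases "level n f s = 0")
      case True
      with \<open>k \<ge> 1 \<and> _\<close> have "(k, f, s) \<in> ground_wall"
        using level_eq_0_iff[of s f] by (simp add: ground_wall_def)
      then show ?thesis
        using gr by (auto simp: wall_of_def)
    next
      case False
      then show ?thesis
        using True in_Y by (simp add: wall_of_iff)
    qed
  next
    case False
    then show ?thesis
      using pl by (auto simp: places_def wall_of_def ground_wall_def slots_eq)
  qed
  then show eq: "Y = wall_of n ?R"
    unfolding set_eq_iff split_paired_All by blast
  have R0: "?R 0 = ?R 1"
    by (simp add: profile_of_def)
  have down: "?R (level n (Suc f) s) \<le> ?R (level n f s')"
    if s: "s \<in> slots n (Suc f)" and s': "s' \<in> slots n f" for f s s'
  proof (cases "?R (level n (Suc f) s) = 0")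
    case False
    let ?k = "?R (level n (Suc f) s)"
    have "level n (Suc f) s \<noteq> 0"
      using level_eq_0_iff[OF s] by simp
    then have "(?k, Suc f, s) \<in> Y"
      using in_Y[OF s, of ?k] False by simp
    then have filled: "floor_filled n Y ?k f"
      by (rule fl)
    show ?thesis
    proof (cases "level n f s' = 0")
      case True
      then have "f = 0" "s' = PosA"
        using level_eq_0_iff[OF s'] by auto
      moreover have "PosB \<in> slots n 0" "level n 0 PosB = 1" "level n 0 PosA = 0"
        by (simp_all add: slots_eq level_def)
      ultimately show ?thesis
        using in_Y[of PosB 0 ?k] filled False R0 by (auto simp: floor_filled_def)
    next
      case False
      then show ?thesis
        using in_Y[OF s' False, of ?k] filled s' \<open>?k \<noteq> 0\<close> by (auto simp: floor_filled_def)
    qed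
  qed simp
  have "reach n ?R (Suc a) \<le> reach n ?R a" for a
  proof (cases "n dvd a")
    case False
    then obtain f where f: "a = high n f"
      using not_dvd_imp_high by blast
    obtain s s' where "s \<in> slots n (Suc f)" "?R (level n (Suc f) s) = reach n ?R (Suc a)"
      "s' \<in> slots n f" "?R (level n f s') = reach n ?R a"
      using reach_low_attained[of "Suc f" ?R] reach_high_attained[of f ?R] low_Suc f by metis
    then show ?thesis
      using down by metis
  next
    case True
    then obtain t where t: "a = n * t"
      by blast
    have m: "a mod (2 * n) = (if even t then 0 else n)" "Suc a mod (2 * n) = (if even t then 1 else n + 1)"
    proof -
      have "a div n = t" "a mod n = 0"
        using n by (simp_all add: t)
      moreover have "Suc a div n = t" "Suc a mod n = 1"
        using div_mult_self2[of n 1 t] mod_mult_self2[of 1 n t] n by (simp_all add: t)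
      ultimately show "a mod (2 * n) = (if even t then 0 else n)"
        "Suc a mod (2 * n) = (if even t then 1 else n + 1)"
        using mod_double[of n a] mod_double[of n "Suc a"] n by simp_all
    qed
    show ?thesis
    proof (cases "even t")
      case True
      then show ?thesis
        using m by (simp add: reach_def)
    next
      case False
      let ?f = "(n - 1) * t"
      have f: "Lower \<in> slots n ?f" "Upper \<in> slots n ?f" "level n ?f Lower = a" "level n ?f Upper = Suc a"
        using False n by (auto simp: slots_eq level_def t)
      have "a \<noteq> 0"
        using odd_pos[OF False] n by (simp add: t)
      then have "?R (Suc a) \<le> ?R a"
        using in_Y[OF f(1), of "?R (Suc a)"] in_Y[OF f(2), of "?R (Suc a)"] ul f
        by (cases "?R (Suc a) = 0") auto
      then show ?thesis
        using m False n by (simp add: reach_def)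
    qed
  qed
  then have anti: "antimono (reach n ?R)"
    by (rule antimonoI[OF lift_Suc_antimono_le])
  have "finite {a. ?R a \<noteq> 0}"
  proof -
    have "(\<lambda>a. (1 :: nat, floor_of n a, slot_of n a)) ` ({a. ?R a \<noteq> 0} - {0}) \<subseteq> Y - ground_wall"
    proof (rule image_subsetI)
      fix a assume a: "a \<in> {a. ?R a \<noteq> 0} - {0}"
      then have "(1, floor_of n a, slot_of n a) \<in> Y"
        using in_Y[OF slot_of_in_slots, of a 1] by (simp add: level_floor_of)
      moreover have "\<not> (floor_of n a = 0 \<and> slot_of n a = PosA)"
        using level_eq_0_iff[OF slot_of_in_slots, of a] a by (simp add: level_floor_of)
      ultimately show "(1, floor_of n a, slot_of n a) \<in> Y - ground_wall"
        by (auto simp: ground_wall_def)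
    qed
    moreover have "inj_on (\<lambda>a. (1 :: nat, floor_of n a, slot_of n a)) ({a. ?R a \<noteq> 0} - {0})"
      by (rule inj_onI) (metis level_floor_of prod.inject)
    ultimately have "finite ({a. ?R a \<noteq> 0} - {0})"
      using finite_imageD[OF finite_subset[OF _ fin]] by blast
    then show ?thesis
      by simp
  qed
  then show "?R \<in> profiles n"
    using R0 anti by (simp add: profiles_def)
qed

lemma bij_betw_wall_of: "bij_betw (wall_of n) (proper_profiles n) {Y. proper_wall n Y}"
proof (rule bij_betw_byWitness[where f' = "profile_of n"]; intro ballI image_subsetI)
  fix R assume "R \<in> proper_profiles n"
  moreover from this have "R \<in> profiles n"
    by (simp add: proper_profiles_def)
  ultimately show "profile_of n (wall_of n R) = R" "wall_of n R \<in> {Y. proper_wall n Y}"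
    using profile_of_wall_of proper_wall_of_iff by auto
next
  fix Y assume Y: "Y \<in> {Y. proper_wall n Y}"
  then have "young_wall n Y"
    by (simp add: proper_wall_def)
  note * = young_wall_eq_wall_of[OF this]
  then show "wall_of n (profile_of n Y) = Y"
    by simp
  show "profile_of n Y \<in> proper_profiles n"
    using proper_wall_of_iff[OF *(2)] * Y by simp
qed

text \<open>The colors of the levels have period \<open>2n\<close> and, apart from \<open>0\<close> and \<open>1\<close>, are symmetric under \<open>r \<mapsto> 2n + 1 - r\<close>.\<close>

lemma level_color_eq:
  "level_color n k a =
    (let r = a mod (2 * n) in
      if r = 0 then of_bool (odd k)
      else if r = 1 then of_bool (even k)
      else if r \<le> n then r
      else 2 * n + 1 - r)"
proof -
  define t w where "t = a div n" and "w = a mod n"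
  have w: "w < n"
    using n by (simp add: w_def)
  have w1: "w - 1 < n - 1"
    using n w by linarith
  have fd: "floor_of n a div (n - 1) = t" "floor_of n a mod (n - 1) = w - 1"
    unfolding floor_of_def t_def[symmetric] w_def[symmetric] using w1 by simp_all
  have "2 * n - 2 = 2 * (n - 1)"
    by simp
  then have f: "floor_of n a mod (2 * n - 2) = (if even t then w - 1 else n - 1 + (w - 1))"
    using mod_double[of "n - 1" "floor_of n a"] n fd by simp
  have r: "a mod (2 * n) = (if even t then w else n + w)"
    using mod_double[of n a] n by (simp add: t_def w_def)
  have s: "slot_of n a = (if w = 0 then if even t then PosA else Lower
      else if w = 1 then if even t then PosB else Upper else Cube)"
    by (simp add: slot_of_def t_def w_def)
  show ?thesis
    unfolding level_color_def block_color.simps f r s Let_def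
    using w n by (cases "even t"; cases "w = 0"; cases "w = 1") auto
qed

lemma cont_wall_of:
  assumes R: "R \<in> profiles n" and L: "\<And>a. a \<ge> L \<Longrightarrow> R a = 0"
  shows "cont n (wall_of n R) i = (\<Sum>a\<in>{1..<L}. card {k \<in> {1..R a}. level_color n k a = i})"
proof -
  let ?S = "SIGMA a:{1..<L}. {k \<in> {1..R a}. level_color n k a = i}"
  let ?pl = "\<lambda>(a, k). (k, floor_of n a, slot_of n a)"
  have "{p \<in> wall_of n R - ground_wall. block_color n p = i} = ?pl ` ?S"
  proof (intro equalityI subsetI)
    fix p assume p: "p \<in> {p \<in> wall_of n R - ground_wall. block_color n p = i}"
    obtain k f s where eq: "p = (k, f, s)"
      by (metis surj_pair)
    have kfs: "k \<ge> 1" "s \<in> slots n f" "k \<le> R (level n f s)" "\<not> (f = 0 \<and> s = PosA)"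
      using p by (auto simp: eq wall_of_def ground_wall_def)
    have "level n f s \<noteq> 0" "\<not> level n f s \<ge> L"
      using level_eq_0_iff[OF kfs(2)] kfs L[of "level n f s"] by auto
    then show "p \<in> ?pl ` ?S"
      using p kfs floor_of_level[OF kfs(2)]
      by (intro image_eqI[of _ _ "(level n f s, k)"]) (auto simp: eq level_color_def)
  next
    fix p assume "p \<in> ?pl ` ?S"
    then obtain a k where p: "p = (k, floor_of n a, slot_of n a)" "1 \<le> a" "1 \<le> k" "k \<le> R a"
      "level_color n k a = i"
      by auto
    have "p \<in> wall_of n R"
      unfolding p(1) wall_of_iff[OF p(3)] using p by (simp add: slot_of_in_slots level_floor_of)
    moreover have "p \<notin> ground_wall"
      using level_eq_0_iff[OF slot_of_in_slots, of a] p by (simp add: ground_wall_def level_floor_of)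
    ultimately show "p \<in> {p \<in> wall_of n R - ground_wall. block_color n p = i}"
      using p by (simp add: level_color_def)
  qed
  moreover have "inj_on ?pl ?S"
    by (rule inj_onI) (auto, metis level_floor_of)
  ultimately show ?thesis
    unfolding cont_def by (simp add: card_image)
qed

end

section \<open>Profiles as signed multiplicities of parts\<close>

text \<open>The value \<open>h b\<close> is the multiplicity of the part \<open>b\<close>, with a sign when \<open>2n\<close> divides \<open>b\<close>.\<close>

definition signed_parts :: "nat \<Rightarrow> (nat \<Rightarrow> int) set" where
  "signed_parts n = {h. finite {b. h b \<noteq> 0} \<and> h 0 = 0 \<and>
     (\<forall>b. \<not> 2 * n dvd b \<longrightarrow> h b \<ge> 0) \<and> (\<forall>b. \<not> n dvd b \<longrightarrow> h b \<le> 1)}"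

definition tail :: "(nat \<Rightarrow> int) \<Rightarrow> nat \<Rightarrow> nat" where
  "tail h a = (\<Sum>b | a \<le> b \<and> h b \<noteq> 0. nat \<bar>h b\<bar>)"

text \<open>The columns \<open>tail h (a + 1) + 1, \<dots>, tail h a\<close> have exactly \<open>a = 2nj\<close> added blocks, hence only one of the
  two top blocks.  A positive sign means that in the first of these columns this block has color \<open>1\<close>.
  Position A has color \<open>1\<close> in the odd columns, so the block is in position A if and only if the sign
  is positive and \<open>tail h (a + 1)\<close> is even, or negative and odd.\<close>

definition profile_of_parts :: "nat \<Rightarrow> (nat \<Rightarrow> int) \<Rightarrow> nat \<Rightarrow> nat" where
  "profile_of_parts n h a =
     (if a mod (2 * n) = 0 then
        if h a > 0 \<longleftrightarrow> even (tail h (Suc a)) then tail h a else tail h (Suc a)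
      else if a mod (2 * n) = 1 then
        if h (a - 1) > 0 \<longleftrightarrow> even (tail h a) then tail h a else tail h (a - 1)
      else tail h a)"

definition parts_of_profile :: "nat \<Rightarrow> (nat \<Rightarrow> nat) \<Rightarrow> nat \<Rightarrow> int" where
  "parts_of_profile n R a =
     (if a mod (2 * n) = 0 \<and> (R a > R (Suc a)) \<noteq> even (reach n R (Suc a)) then - 1 else 1) *
     (int (reach n R a) - int (reach n R (Suc a)))"

lemma tail_Suc:
  assumes "finite {b. h b \<noteq> 0}"
  shows "tail h a = nat \<bar>h a\<bar> + tail h (Suc a)"
proof -
  have fin: "finite {b. Suc a \<le> b \<and> h b \<noteq> 0}"
    by (rule finite_subset[OF _ assms]) auto
  show ?thesis
  proof (cases "h a = 0")
    case True
    then have "{b. a \<le> b \<and> h b \<noteq> 0} = {b. Suc a \<le> b \<and> h b \<noteq> 0}"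
      by (auto simp: Suc_le_eq le_less)
    then show ?thesis
      using True by (simp add: tail_def)
  next
    case False
    then have "{b. a \<le> b \<and> h b \<noteq> 0} = insert a {b. Suc a \<le> b \<and> h b \<noteq> 0}"
      by (auto simp: Suc_le_eq le_less)
    then show ?thesis
      using fin by (simp add: tail_def)
  qed
qed

lemma tail_eq_0:
  assumes "\<And>b. b \<ge> L \<Longrightarrow> h b = 0" "a \<ge> L"
  shows "tail h a = 0"
  unfolding tail_def by (rule sum.neutral) (use assms in auto)

lemma tail_unique:
  assumes fin: "finite {b. h b \<noteq> 0}" and step: "\<And>a. f a = nat \<bar>h a\<bar> + f (Suc a)"
    and L: "\<And>a. a \<ge> L \<Longrightarrow> f a = 0"
  shows "f a = tail h a"
proof (cases "a \<le> L")
  case True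
  have "h b = 0" if "b \<ge> L" for b
    using step[of b] L[of b] that by simp
  then have L': "tail h b = 0" if "b \<ge> L" for b
    using that by (intro tail_eq_0[of L])
  from True show ?thesis
  proof (induction rule: inc_induct)
    case base
    then show ?case
      using L L' by simp
  next
    case (step i)
    then show ?case
      using assms(2)[of i] tail_Suc[OF fin, of i] by simp
  qed
next
  case False
  have "h b = 0" if "b \<ge> L" for b
    using step[of b] L[of b] that by simp
  then show ?thesis
    using False L by (subst tail_eq_0[of L]) auto
qed

context
  fixes n :: nat
  assumes n: "n \<ge> 3"
begin

lemma Suc_mod_2n:
  "a mod (2 * n) = 0 \<Longrightarrow> Suc a mod (2 * n) = 1"
  "Suc a mod (2 * n) = 1 \<Longrightarrow> a mod (2 * n) = 0"
  using n by (auto simp: mod_Suc split: if_splits)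

lemma residue_cases:
  obtains "a mod (2 * n) = 0" | b where "a = Suc b" "a mod (2 * n) = 1" | "a mod (2 * n) > 1"
proof (cases a)
  case 0
  then show ?thesis
    using that(1) by simp
next
  case (Suc b)
  then show ?thesis
    using that by (metis less_one linorder_neqE_nat)
qed

lemma reach_profile_of_parts:
  assumes fin: "finite {b. h b \<noteq> 0}"
  shows "reach n (profile_of_parts n h) = tail h"
proof
  fix a
  have le: "tail h (Suc a) \<le> tail h a" for a
    using tail_Suc[OF fin, of a] by simp
  consider "a mod (2 * n) = 0" | b where "a = Suc b" "a mod (2 * n) = 1" | "a mod (2 * n) > 1"
    by (rule residue_cases)
  then show "reach n (profile_of_parts n h) a = tail h a"
  proof cases
    case 1
    then show ?thesis
      using Suc_mod_2n(1)[of a] le[of a] by (simp add: reach_def profile_of_parts_def max_def)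
  next
    case 2
    then show ?thesis
      using Suc_mod_2n(2)[of b] le[of b] by (simp add: reach_def profile_of_parts_def min_def)
  next
    case 3
    then show ?thesis
      by (simp add: reach_def profile_of_parts_def)
  qed
qed

lemma parts_of_profile_of_parts:
  assumes h: "h \<in> signed_parts n"
  shows "parts_of_profile n (profile_of_parts n h) = h"
proof
  fix a
  have fin: "finite {b. h b \<noteq> 0}"
    using h by (simp add: signed_parts_def)
  have d: "int (tail h a) - int (tail h (Suc a)) = \<bar>h a\<bar>"
    using tail_Suc[OF fin, of a] by simp
  show "parts_of_profile n (profile_of_parts n h) a = h a"
  proof (cases "a mod (2 * n) = 0")
    case True
    have "profile_of_parts n h a > profile_of_parts n h (Suc a) \<longleftrightarrow>
        h a \<noteq> 0 \<and> (h a > 0 \<longleftrightarrow> even (tail h (Suc a)))"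
      using True Suc_mod_2n(1)[OF True] d by (auto simp: profile_of_parts_def)
    then show ?thesis
      unfolding parts_of_profile_def reach_profile_of_parts[OF fin] d using True by auto
  next
    case False
    then have "h a \<ge> 0"
      using h by (simp add: signed_parts_def dvd_eq_mod_eq_0)
    then show ?thesis
      unfolding parts_of_profile_def reach_profile_of_parts[OF fin] d using False by simp
  qed
qed

lemma reach_eventually_0:
  assumes "R \<in> profiles n"
  shows "\<exists>L. \<forall>a\<ge>L. reach n R a = 0"
proof -
  have "finite {a. R a \<noteq> 0}"
    using assms by (simp add: profiles_def)
  then obtain L where L: "{a. R a \<noteq> 0} \<subseteq> {..<L}"
    using finite_nat_bounded by blast
  have "R a = 0" if "a \<ge> L" for a
    using L that by force
  then have "\<forall>a\<ge>Suc L. reach n R a = 0"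
    by (simp add: reach_def)
  then show ?thesis ..
qed

lemma tail_parts_of_profile:
  assumes R: "R \<in> profiles n"
  shows "finite {a. parts_of_profile n R a \<noteq> 0}" "tail (parts_of_profile n R) = reach n R"
proof -
  obtain L where "\<forall>a\<ge>L. reach n R a = 0"
    using reach_eventually_0[OF R] by blast
  then have L: "reach n R a = 0" if "a \<ge> L" for a
    using that by blast
  have "{a. parts_of_profile n R a \<noteq> 0} \<subseteq> {..<L}"
  proof (intro subsetI, rule ccontr)
    fix a assume "a \<in> {a. parts_of_profile n R a \<noteq> 0}" "a \<notin> {..<L}"
    then show False
      using L[of a] L[of "Suc a"] by (simp add: parts_of_profile_def)
  qed
  then show fin: "finite {a. parts_of_profile n R a \<noteq> 0}"
    by (rule finite_subset) simp
  have le: "reach n R (Suc a) \<le> reach n R a" for a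
    using R by (auto simp: profiles_def dest: antimonoD[of _ a "Suc a"])
  have step: "reach n R a = nat \<bar>parts_of_profile n R a\<bar> + reach n R (Suc a)" for a
    using le[of a] by (auto simp: parts_of_profile_def)
  show "tail (parts_of_profile n R) = reach n R"
    by (rule ext, rule tail_unique[OF fin step L, symmetric])
qed

lemma profile_of_parts_of_profile:
  assumes R: "R \<in> profiles n"
  shows "profile_of_parts n (parts_of_profile n R) = R"
proof
  fix a
  let ?h = "parts_of_profile n R"
  have t: "tail ?h = reach n R"
    using tail_parts_of_profile[OF R] by simp
  consider "a mod (2 * n) = 0" | b where "a = Suc b" "a mod (2 * n) = 1" | "a mod (2 * n) > 1"
    by (rule residue_cases)
  then show "profile_of_parts n ?h a = R a"
  proof cases
    case 1
    note r = 1 Suc_mod_2n(1)[OF 1]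
    have "reach n R a = max (R a) (R (Suc a))" "reach n R (Suc a) = min (R a) (R (Suc a))"
      using r by (simp_all add: reach_def)
    then show ?thesis
      unfolding profile_of_parts_def t using r
      by (cases "R a = R (Suc a)"; cases "R a > R (Suc a)") (auto simp: parts_of_profile_def)
  next
    case 2
    then have r: "b mod (2 * n) = 0" "Suc b mod (2 * n) = 1"
      using Suc_mod_2n(2)[of b] by auto
    have "reach n R b = max (R b) (R (Suc b))" "reach n R (Suc b) = min (R b) (R (Suc b))"
      using r by (simp_all add: reach_def)
    then show ?thesis
      unfolding profile_of_parts_def t using r 2
      by (cases "R b = R (Suc b)"; cases "R b > R (Suc b)") (auto simp: parts_of_profile_def)
  next
    case 3
    then show ?thesis
      by (simp add: t reach_def profile_of_parts_def)
  qed
qed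

lemma profile_of_parts_zero:
  assumes "\<And>b. b \<ge> 2 * n * J \<Longrightarrow> h b = 0" "a \<ge> 2 * n * J"
  shows "profile_of_parts n h a = 0"
proof -
  have t: "tail h a = 0" if "a \<ge> 2 * n * J" for a
    using tail_eq_0[of "2 * n * J" h a] assms(1) that by blast
  have "a - 1 \<ge> 2 * n * J" if "a mod (2 * n) = 1"
    using that assms(2) by (cases "a = 2 * n * J") auto
  then show ?thesis
    using assms(2) t[of a] t[of "Suc a"] t[of "a - 1"] by (simp add: profile_of_parts_def)
qed

lemma parts_bound:
  assumes "h \<in> signed_parts n"
  obtains J where "\<And>b. b \<ge> 2 * n * J \<Longrightarrow> h b = 0"
proof -
  obtain J where J: "\<And>b. h b \<noteq> 0 \<Longrightarrow> b < J"
    using assms finite_nat_bounded[of "{b. h b \<noteq> 0}"] by (auto simp: signed_parts_def)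
  have "h b = 0" if "b \<ge> 2 * n * J" for b
  proof -
    have "1 * J \<le> 2 * n * J"
      by (rule mult_le_mono1) (use n in simp)
    with that have "\<not> b < J"
      by linarith
    then show ?thesis
      using J by blast
  qed
  then show ?thesis
    by (rule that)
qed

lemma bij_betw_profile_of_parts:
  "bij_betw (profile_of_parts n) (signed_parts n) (proper_profiles n)"
proof (rule bij_betw_byWitness[where f' = "parts_of_profile n"]; intro ballI image_subsetI)
  fix h assume h: "h \<in> signed_parts n"
  let ?R = "profile_of_parts n h"
  show "parts_of_profile n ?R = h"
    by (rule parts_of_profile_of_parts[OF h])
  have fin: "finite {b. h b \<noteq> 0}"
    using h by (simp add: signed_parts_def)
  obtain J where J: "\<And>b. b \<ge> 2 * n * J \<Longrightarrow> h b = 0"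
    using parts_bound[OF h] by blast
  have "{a. ?R a \<noteq> 0} \<subseteq> {..<2 * n * J}"
  proof (intro subsetI, rule ccontr)
    fix a assume "a \<in> {a. ?R a \<noteq> 0}" "a \<notin> {..<2 * n * J}"
    then show False
      using profile_of_parts_zero[of J h a, OF J] by simp
  qed
  then have "finite {a. ?R a \<noteq> 0}"
    by (rule finite_subset) simp
  moreover have "?R 0 = ?R 1"
    using h n tail_Suc[OF fin, of 0] by (simp add: profile_of_parts_def signed_parts_def)
  moreover have "tail h (Suc a) \<le> tail h a" for a
    using tail_Suc[OF fin, of a] by simp
  then have "antimono (tail h)"
    by (rule antimonoI[OF lift_Suc_antimono_le])
  moreover have "tail h a \<le> tail h (Suc a) + 1" if "\<not> n dvd a" for a
  proof -
    have "\<not> 2 * n dvd a"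
      using that by (meson dvd_mult_right)
    then have "0 \<le> h a" "h a \<le> 1"
      using h that by (auto simp: signed_parts_def)
    then show ?thesis
      using tail_Suc[OF fin, of a] by simp
  qed
  ultimately show "?R \<in> proper_profiles n"
    by (simp add: proper_profiles_def profiles_def reach_profile_of_parts[OF fin])
next
  fix R assume R: "R \<in> proper_profiles n"
  then have R': "R \<in> profiles n"
    by (simp add: proper_profiles_def)
  show "profile_of_parts n (parts_of_profile n R) = R"
    by (rule profile_of_parts_of_profile[OF R'])
  have le: "reach n R (Suc a) \<le> reach n R a" for a
    using R' by (auto simp: profiles_def dest: antimonoD[of _ a "Suc a"])
  show "parts_of_profile n R \<in> signed_parts n"
    unfolding signed_parts_def mem_Collect_eq
  proof (intro conjI allI impI)
    show "finite {b. parts_of_profile n R b \<noteq> 0}"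
      by (rule tail_parts_of_profile(1)[OF R'])
    show "parts_of_profile n R 0 = 0"
      using R' n by (simp add: parts_of_profile_def profiles_def reach_def)
  next
    fix b assume "\<not> 2 * n dvd b"
    then show "parts_of_profile n R b \<ge> 0"
      using le[of b] by (simp add: parts_of_profile_def dvd_eq_mod_eq_0)
  next
    fix b assume b: "\<not> n dvd b"
    then have "\<not> 2 * n dvd b"
      by (meson dvd_mult_right)
    moreover have "reach n R b \<le> reach n R (Suc b) + 1"
      using R b by (simp add: proper_profiles_def)
    ultimately show "parts_of_profile n R b \<le> 1"
      by (simp add: parts_of_profile_def dvd_eq_mod_eq_0)
  qed
qed

end

section \<open>The content of a wall\<close>

text \<open>The number of blocks of color \<open>n\<close> in a column with \<open>b\<close> added blocks.\<close>

definition half_weight :: "nat \<Rightarrow> nat \<Rightarrow> nat" where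
  "half_weight n b = 2 * (b div (2 * n)) + of_bool (b mod (2 * n) \<ge> n) + of_bool (b mod (2 * n) > n)"

text \<open>The parts not divisible by \<open>n\<close> have multiplicity at most one, so the two cardinalities are numbers of parts.\<close>

definition balanced :: "nat \<Rightarrow> (nat \<Rightarrow> int) \<Rightarrow> bool" where
  "balanced n h \<longleftrightarrow> (\<forall>i\<in>{1..<n}.
     card {j. h (2 * n * j + i) \<noteq> 0} = card {j. h (2 * n * j + (2 * n - i)) \<noteq> 0})"

definition total_weight :: "nat \<Rightarrow> (nat \<Rightarrow> int) \<Rightarrow> nat" where
  "total_weight n h = mult_weight (half_weight n) (\<lambda>b. nat \<bar>h b\<bar>)"

text \<open>The number of blocks of color \<open>i\<close> for \<open>2 \<le> i \<le> n\<close>, and of the colors \<open>0\<close> and \<open>1\<close> together for \<open>i = 1\<close>,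
  when all parts are smaller than \<open>2nJ\<close>.\<close>

definition color_count :: "nat \<Rightarrow> (nat \<Rightarrow> int) \<Rightarrow> nat \<Rightarrow> nat \<Rightarrow> nat" where
  "color_count n h J i = (\<Sum>j<J. tail h (2 * n * j + i) + tail h (2 * n * j + (2 * n + 1 - i)))"

lemma sum_by_residue:
  "(\<Sum>a<N * J. F a) = (\<Sum>j<J. \<Sum>r<N. F (N * j + r :: nat))"
proof -
  have "(\<Sum>j<J. sum F {j * N..<j * N + N}) = (\<Sum>a<J * N. F a)"
    by (rule sum.nat_group)
  moreover have "sum F {j * N..<j * N + N} = (\<Sum>r<N. F (N * j + r))" for j
    using sum.shift_bounds_nat_ivl[of F 0 "j * N" N]
    by (simp add: atLeast0LessThan add.commute mult.commute)
  ultimately show ?thesis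
    by (simp add: mult.commute)
qed

lemma sum_two_residues:
  fixes F :: "nat \<Rightarrow> 'a::comm_monoid_add"
  assumes "p < N" "q < N" "p \<noteq> q"
    and zero: "\<And>a. a mod N \<noteq> p \<Longrightarrow> a mod N \<noteq> q \<Longrightarrow> F a = 0"
  shows "(\<Sum>a<N * J. F a) = (\<Sum>j<J. F (N * j + p) + F (N * j + q))"
  unfolding sum_by_residue
proof (rule sum.cong)
  fix j
  have "(\<Sum>r<N. F (N * j + r)) = (\<Sum>r\<in>{p, q}. F (N * j + r))"
    by (rule sum.mono_neutral_right) (use assms in auto)
  then show "(\<Sum>r<N. F (N * j + r)) = F (N * j + p) + F (N * j + q)"
    using assms(3) by simp
qed simp

lemma sum_paired_residues:
  fixes F :: "nat \<Rightarrow> 'a::comm_monoid_add"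
  assumes n: "n > 0"
  shows "(\<Sum>a<2 * n * J. F a) = (\<Sum>j<J. F (2 * n * j)) + (\<Sum>j<J. F (2 * n * j + n)) +
    (\<Sum>i\<in>{1..<n}. \<Sum>j<J. F (2 * n * j + i) + F (2 * n * j + (2 * n - i)))"
proof -
  have split: "(\<Sum>r<2 * n. G r) = G 0 + G n + (\<Sum>i\<in>{1..<n}. G i + G (2 * n - i))" for G :: "nat \<Rightarrow> 'a"
  proof -
    have "{..<2 * n} = insert 0 (insert n ({1..<n} \<union> {n<..<2 * n}))"
      using n by auto
    then have "(\<Sum>r<2 * n. G r) = G 0 + (G n + (\<Sum>r\<in>{1..<n} \<union> {n<..<2 * n}. G r))"
      using n by simp
    also have "(\<Sum>r\<in>{1..<n} \<union> {n<..<2 * n}. G r) = (\<Sum>i\<in>{1..<n}. G i) + (\<Sum>r\<in>{n<..<2 * n}. G r)"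
      by (rule sum.union_disjoint) auto
    also have "(\<Sum>r\<in>{n<..<2 * n}. G r) = (\<Sum>i\<in>{1..<n}. G (2 * n - i))"
      by (rule sum.reindex_bij_witness[of _ "\<lambda>i. 2 * n - i" "\<lambda>i. 2 * n - i"]) auto
    finally show ?thesis
      by (simp add: sum.distrib add.assoc)
  qed
  show ?thesis
    unfolding sum_by_residue[where N = "2 * n" and J = J and F = F] split sum.distrib
    by (subst sum.swap[of _ "{1..<n}"], subst sum.swap[of _ "{1..<n}"]) (simp add: add.assoc)
qed

text \<open>The colors \<open>0\<close> and \<open>1\<close> are distributed over the columns according to parity.\<close>

lemma card_odd_even:
  "int (card {k \<in> {1..m}. odd k}) - int (card {k \<in> {1..m}. even k}) = of_bool (odd m)"
  "card {k \<in> {1..m}. odd k} + card {k \<in> {1..m :: nat}. even k} = m"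
proof (induction m)
  case (Suc m)
  have "{k \<in> {1..Suc m}. P k} = (if P (Suc m) then insert (Suc m) {k \<in> {1..m}. P k} else {k \<in> {1..m}. P k})" for P
    by (auto simp: le_Suc_eq)
  then have "card {k \<in> {1..Suc m}. P k} = card {k \<in> {1..m}. P k} + of_bool (P (Suc m))" for P
    by simp
  note * = this[of odd] this[of even]
  {
    case 1
    show ?case
      using Suc(1) unfolding * by auto
  next
    case 2
    show ?case
      using Suc(2) unfolding * by auto
  }
qed auto

context
  fixes n :: nat
  assumes n: "n \<ge> 3"
begin

lemma half_weight_sum:
  "(\<Sum>a\<le>b. of_bool (a mod (2 * n) = n \<or> a mod (2 * n) = Suc n)) = half_weight n b"
proof (induction b)
  case 0
  then show ?case
    using n by (simp add: half_weight_def)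
next
  case (Suc b)
  have "b mod (2 * n) < 2 * n"
    using n by simp
  then show ?case
    using Suc n by (cases "Suc (b mod (2 * n)) = 2 * n") (auto simp: half_weight_def div_Suc mod_Suc)
qed

lemma half_weight_residue:
  assumes "r < 2 * n"
  shows "half_weight n (2 * n * j + r) = 2 * j + of_bool (r \<ge> n) + of_bool (r > n)"
  using assms n by (simp add: half_weight_def)

context
  fixes h J
  assumes h: "h \<in> signed_parts n" and J: "\<And>b. b \<ge> 2 * n * J \<Longrightarrow> h b = 0"
begin

private abbreviation (input) "t \<equiv> tail h"
private abbreviation (input) "R \<equiv> profile_of_parts n h"

lemma fin_h: "finite {b. h b \<noteq> 0}"
  using h by (simp add: signed_parts_def)

lemma tail_bound: "a \<ge> 2 * n * J \<Longrightarrow> t a = 0"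
  using tail_eq_0[of "2 * n * J" h a] J by blast

lemma tail_conv_sum:
  "t a = (\<Sum>b\<in>{a..<2 * n * J}. nat \<bar>h b\<bar>)"
  unfolding tail_def
proof (rule sum.mono_neutral_left)
  show "{b. a \<le> b \<and> h b \<noteq> 0} \<subseteq> {a..<2 * n * J}"
    using J by (auto simp: not_less intro: ccontr)
qed auto

lemma total_weight_eq:
  "total_weight n h = (\<Sum>b<2 * n * J. half_weight n b * nat \<bar>h b\<bar>)"
  unfolding total_weight_def
proof (rule mult_weight_eq)
  show "nat \<bar>h j\<bar> = 0" if "j \<notin> {..<2 * n * J}" for j
    using J[of j] that by simp
qed simp

text \<open>Summation by parts: a column with \<open>b\<close> added blocks is counted once for every level of color \<open>n\<close> up to \<open>b\<close>.\<close>

lemma total_weight_conv_tail: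
  "total_weight n h = (\<Sum>j<J. t (2 * n * j + n) + t (2 * n * j + (n + 1)))"
proof -
  let ?e = "\<lambda>a. of_bool (a mod (2 * n) = n \<or> a mod (2 * n) = Suc n) :: nat"
  let ?L = "2 * n * J"
  have "(\<Sum>j<J. t (2 * n * j + n) + t (2 * n * j + (n + 1))) = (\<Sum>a<?L. ?e a * t a)"
    using n by (subst sum_two_residues[of n "2 * n" "Suc n"]) auto
  also have "\<dots> = (\<Sum>a<?L. \<Sum>b<?L. if a \<le> b then ?e a * nat \<bar>h b\<bar> else 0)"
  proof (rule sum.cong)
    fix a
    have "?e a * t a = (\<Sum>b\<in>{a..<?L}. ?e a * nat \<bar>h b\<bar>)"
      unfolding tail_conv_sum by (rule sum_distrib_left)
    also have "\<dots> = (\<Sum>b<?L. if a \<le> b then ?e a * nat \<bar>h b\<bar> else 0)"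
      by (rule sum.mono_neutral_cong_left) auto
    finally show "?e a * t a = (\<Sum>b<?L. if a \<le> b then ?e a * nat \<bar>h b\<bar> else 0)" .
  qed simp
  also have "\<dots> = (\<Sum>b<?L. \<Sum>a<?L. if a \<le> b then ?e a * nat \<bar>h b\<bar> else 0)"
    by (rule sum.swap)
  also have "\<dots> = (\<Sum>b<?L. half_weight n b * nat \<bar>h b\<bar>)"
  proof (rule sum.cong)
    fix b assume b: "b \<in> {..<?L}"
    have "(\<Sum>a<?L. if a \<le> b then ?e a * nat \<bar>h b\<bar> else 0) = (\<Sum>a\<le>b. ?e a * nat \<bar>h b\<bar>)"
      by (rule sum.mono_neutral_cong_right) (use b in auto)
    also have "\<dots> = half_weight n b * nat \<bar>h b\<bar>"
      by (simp only: half_weight_sum sum_distrib_right[symmetric])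
    finally show "(\<Sum>a<?L. if a \<le> b then ?e a * nat \<bar>h b\<bar> else 0) = half_weight n b * nat \<bar>h b\<bar>" .
  qed simp
  finally show ?thesis
    by (simp only: total_weight_eq)
qed

lemma color_count_n: "color_count n h J n = total_weight n h"
  using n by (simp add: color_count_def total_weight_conv_tail)

lemma residue_01:
  assumes r: "\<not> n dvd r"
  shows "nat \<bar>h (2 * n * j + r)\<bar> = of_bool (h (2 * n * j + r) \<noteq> 0)"
proof -
  have nd: "\<not> n dvd 2 * n * j + r"
    using r by (metis dvd_add_right_iff dvd_mult2 dvd_triv_right)
  then have "\<not> 2 * n dvd 2 * n * j + r"
    by (meson dvd_mult_right)
  then have "0 \<le> h (2 * n * j + r)" "h (2 * n * j + r) \<le> 1"
    using h nd by (auto simp: signed_parts_def)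
  then show ?thesis
    by auto
qed

lemma residue_bound: "{j. h (2 * n * j + r) \<noteq> 0} \<subseteq> {..<J}"
proof (intro subsetI, rule ccontr)
  fix j assume j: "j \<in> {j. h (2 * n * j + r) \<noteq> 0}" "j \<notin> {..<J}"
  then have "2 * n * J \<le> 2 * n * j + r"
    by (simp add: trans_le_add1)
  then show False
    using J j by blast
qed

lemma residue_sum:
  fixes f :: "nat \<Rightarrow> 'a::semiring_1"
  assumes r: "\<not> n dvd r"
  shows "(\<Sum>j<J. f j * of_nat (nat \<bar>h (2 * n * j + r)\<bar>)) = (\<Sum>j | h (2 * n * j + r) \<noteq> 0. f j)"
  by (rule sum.mono_neutral_cong_right) (use residue_bound in \<open>auto simp: residue_01[OF r]\<close>)

lemma residue_count:
  assumes r: "\<not> n dvd r"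
  shows "(\<Sum>j<J. int (nat \<bar>h (2 * n * j + r)\<bar>)) = int (card {j. h (2 * n * j + r) \<noteq> 0})"
  using residue_sum[OF r, of "\<lambda>_. 1 :: int"] by simp

lemma residue_not_dvd:
  assumes i: "i \<in> {1..<n}"
  shows "\<not> n dvd i" "\<not> n dvd 2 * n - i"
proof -
  show nd1: "\<not> n dvd i"
    using i by (auto dest: dvd_imp_le)
  show "\<not> n dvd 2 * n - i"
  proof
    assume "n dvd 2 * n - i"
    then have "n dvd 2 * n - (2 * n - i)"
      by (rule dvd_diff_nat[OF dvd_triv_right])
    then show False
      using nd1 i by simp
  qed
qed

text \<open>Passing from \<open>i\<close> to \<open>i + 1\<close> replaces the level \<open>2nj + i\<close> by the next one and the level \<open>2nj + 2n + 1 - i\<close>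
  by the previous one.  The loss and the gain are multiplicities of single parts.\<close>

lemma color_count_diff:
  assumes i: "i \<in> {1..<n}"
  shows "int (color_count n h J i) - int (color_count n h J (Suc i)) =
    int (card {j. h (2 * n * j + i) \<noteq> 0}) - int (card {j. h (2 * n * j + (2 * n - i)) \<noteq> 0})"
proof -
  have step: "int (t a) - int (t (Suc a)) = int (nat \<bar>h a\<bar>)" for a
    using tail_Suc[OF fin_h, of a] by simp
  have e: "2 * n + 1 - i = Suc (2 * n - i)" "2 * n + 1 - Suc i = 2 * n - i"
    using i by auto
  have "int (color_count n h J i) - int (color_count n h J (Suc i)) =
      (\<Sum>j<J. int (t (2 * n * j + i)) - int (t (Suc (2 * n * j + i)))) -
      (\<Sum>j<J. int (t (2 * n * j + (2 * n - i))) - int (t (Suc (2 * n * j + (2 * n - i)))))"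
    unfolding color_count_def e by (simp add: sum.distrib sum_subtractf)
  then show ?thesis
    unfolding step residue_count[OF residue_not_dvd(1)[OF i]] residue_count[OF residue_not_dvd(2)[OF i]] .
qed

lemma cont_eq:
  "cont n (wall_of n R) i = (\<Sum>a\<in>{1..<2 * n * J}. card {k \<in> {1..R a}. level_color n k a = i})"
proof (rule cont_wall_of[OF n])
  show "R \<in> profiles n"
    using bij_betwE[OF bij_betw_profile_of_parts[OF n]] h by (auto simp: proper_profiles_def)
  show "R a = 0" if "a \<ge> 2 * n * J" for a
    using profile_of_parts_zero[OF n, of J h a, OF J] that by blast
qed

lemma sum_without_0: "(\<Sum>a<L. F a) = F 0 + (\<Sum>a\<in>{1..<L}. F a)" if "L > 0" for F :: "nat \<Rightarrow> 'a::comm_monoid_add"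
  using that by (simp add: lessThan_atLeast0 sum.atLeast_Suc_lessThan)

lemma cont_middle:
  assumes i: "2 \<le> i" "i \<le> n"
  shows "cont n (wall_of n R) i = color_count n h J i"
proof (cases "J = 0")
  case True
  then show ?thesis
    by (simp add: cont_eq color_count_def)
next
  case False
  let ?F = "\<lambda>a. if a mod (2 * n) = i \<or> a mod (2 * n) = 2 * n + 1 - i then t a else 0"
  have *: "card {k \<in> {1..R a}. level_color n k a = i} = ?F a" for a
  proof (cases "a mod (2 * n) = i \<or> a mod (2 * n) = 2 * n + 1 - i")
    case True
    then have "level_color n k a = i" for k
      using i by (auto simp: level_color_eq[OF n] Let_def)
    then have "{k \<in> {1..R a}. level_color n k a = i} = {1..R a}"
      by auto
    moreover have "R a = t a"
      using True i by (auto simp: profile_of_parts_def)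
    ultimately show ?thesis
      using True by simp
  next
    case False
    obtain r where r: "a mod (2 * n) = r" "r < 2 * n"
      using n by simp
    have "level_color n k a \<noteq> i" for k
      using i False r(2) by (auto simp: level_color_eq[OF n] Let_def r(1))
    then show ?thesis
      using False by simp
  qed
  have "cont n (wall_of n R) i = (\<Sum>a\<in>{1..<2 * n * J}. ?F a)"
    unfolding cont_eq * ..
  also have "\<dots> = (\<Sum>a<2 * n * J. ?F a)"
    using False i n by (subst sum_without_0) auto
  also have "\<dots> = color_count n h J i"
  proof -
    obtain q where q: "2 * n + 1 - i = q" "q < 2 * n" "q \<noteq> i"
      using i n by force
    have "(\<Sum>a<2 * n * J. ?F a) = (\<Sum>j<J. ?F (2 * n * j + i) + ?F (2 * n * j + q))"
      using i q by (intro sum_two_residues) auto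
    also have "\<dots> = color_count n h J i"
      unfolding color_count_def q(1) using i q(2) by (intro sum.cong) auto
    finally show ?thesis .
  qed
  finally show ?thesis .
qed

lemma cont_large: "i > n \<Longrightarrow> cont n (wall_of n R) i = 0"
proof -
  assume i: "i > n"
  have "level_color n k a \<noteq> i" for k a
    using i n by (auto simp: level_color_eq[OF n] Let_def)
  then show ?thesis
    by (simp add: cont_eq)
qed

lemma charge_conv_sum:
  "(\<Sum>j<J. if odd (h (2 * n * j)) then sgn (h (2 * n * j)) else 0 :: int) =
    charge (\<lambda>j. h (2 * n * Suc j))"
proof -
  have h0: "h 0 = 0"
    using h by (simp add: signed_parts_def)
  let ?g = "\<lambda>j. if odd (h (2 * n * j)) then sgn (h (2 * n * j)) else 0 :: int"
  have big: "h (2 * n * j) = 0" if "j \<ge> J" for j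
    using that by (intro J) simp
  have "charge (\<lambda>j. h (2 * n * Suc j)) = (\<Sum>j<J. ?g (Suc j))"
    unfolding charge_def
  proof (rule sum.mono_neutral_cong_left)
    show "{j. odd (h (2 * n * Suc j))} \<subseteq> {..<J}"
    proof (intro subsetI, rule ccontr)
      fix j assume "j \<in> {j. odd (h (2 * n * Suc j))}" "j \<notin> {..<J}"
      then show False
        using big[of "Suc j"] by simp
    qed
  qed auto
  also have "\<dots> = ?g 0 + (\<Sum>j<J. ?g (Suc j))"
    using h0 by simp
  also have "\<dots> = (\<Sum>j<Suc J. ?g j)"
    by (rule sum.lessThan_Suc_shift[symmetric])
  also have "\<dots> = (\<Sum>j<J. ?g j)"
    using big[of J] by simp
  finally show ?thesis ..
qed

text \<open>In a column where both blocks of a split floor are present, they have different colors.  So every split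
  floor contributes to the difference only through its columns with a single added block.  On the bottom
  floor these are all \<open>t 0\<close> columns with an added block, with the colors \<open>0, 1, 0, \<dots>\<close>; on a higher
  floor they are a run of columns whose colors alternate and start with the color given by the sign of \<open>h\<close>.\<close>

lemma cont_01:
  "cont n (wall_of n R) 0 + cont n (wall_of n R) 1 = color_count n h J 1"
  "int (cont n (wall_of n R) 0) - int (cont n (wall_of n R) 1) =
     of_bool (odd (t 0)) - charge (\<lambda>j. h (2 * n * Suc j))"
proof -
  let ?C = "\<lambda>i a. card {k \<in> {1..R a}. level_color n k a = i}"
  have h0: "h 0 = 0"
    using h by (simp add: signed_parts_def)
  have t01: "t 0 = t 1"
    using tail_Suc[OF fin_h, of 0] h0 by simp
  have R0: "R 0 = t 0"
    using t01 by (simp add: profile_of_parts_def)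
  have r0: "{k \<in> {1..R a}. level_color n k a = 0} = {k \<in> {1..R a}. even k}"
    "{k \<in> {1..R a}. level_color n k a = 1} = {k \<in> {1..R a}. odd k}" if "a mod (2 * n) = 0" for a
    using that by (auto simp: level_color_eq[OF n] Let_def)
  have r1: "{k \<in> {1..R a}. level_color n k a = 0} = {k \<in> {1..R a}. odd k}"
    "{k \<in> {1..R a}. level_color n k a = 1} = {k \<in> {1..R a}. even k}" if "a mod (2 * n) = 1" for a
    using that by (auto simp: level_color_eq[OF n] Let_def)
  have r2: "{k \<in> {1..R a}. level_color n k a = 0} = {}" "{k \<in> {1..R a}. level_color n k a = 1} = {}"
    if "a mod (2 * n) \<noteq> 0" "a mod (2 * n) \<noteq> 1" for a
  proof -
    obtain r where r: "a mod (2 * n) = r" "r < 2 * n"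
      using n by simp
    have "level_color n k a \<noteq> 0" "level_color n k a \<noteq> 1" for k
      using that r(2) n by (auto simp: level_color_eq[OF n] Let_def r(1))
    then show "{k \<in> {1..R a}. level_color n k a = 0} = {}" "{k \<in> {1..R a}. level_color n k a = 1} = {}"
      by auto
  qed
  have S: "?C 0 a + ?C 1 a = (if a mod (2 * n) = 0 \<or> a mod (2 * n) = 1 then R a else 0)" for a
    using card_odd_even(2)[of "R a"] r0[of a] r1[of a] r2[of a]
    by (cases "a mod (2 * n) = 0"; cases "a mod (2 * n) = 1") (simp_all add: add.commute)
  let ?D = "\<lambda>a. if a mod (2 * n) = 0 then - of_bool (odd (R a))
      else if a mod (2 * n) = 1 then of_bool (odd (R a)) else 0 :: int"
  have D: "int (?C 0 a) - int (?C 1 a) = ?D a" for a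
  proof (cases "a mod (2 * n) \<noteq> 0 \<and> a mod (2 * n) \<noteq> 1")
    case True
    then have "a mod (2 * n) \<noteq> 0" "a mod (2 * n) \<noteq> 1"
      by auto
    then show ?thesis
      unfolding r2[OF \<open>a mod (2 * n) \<noteq> 0\<close> \<open>a mod (2 * n) \<noteq> 1\<close>] by simp
  next
    case False
    then show ?thesis
      using card_odd_even(1)[of "R a"] r0[of a] r1[of a] by (cases "a mod (2 * n) = 0") simp_all
  qed
  \<comment> \<open>The two counts on a split floor are the two values of the tail, in an order that depends on the sign.\<close>
  have pair: "R (2 * n * j) + R (2 * n * j + 1) = t (2 * n * j) + t (2 * n * j + 1)"
    "- of_bool (odd (R (2 * n * j))) + of_bool (odd (R (2 * n * j + 1))) =
      - (if odd (h (2 * n * j)) then sgn (h (2 * n * j)) else 0 :: int)" for j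
  proof -
    have "(2 * n * j) mod (2 * n) = 0" "Suc (2 * n * j) mod (2 * n) = 1"
      using n by (simp, subst mod_Suc) auto
    then have R: "R (2 * n * j) = (if h (2 * n * j) > 0 \<longleftrightarrow> even (t (2 * n * j + 1)) then t (2 * n * j) else t (2 * n * j + 1))"
      "R (2 * n * j + 1) = (if h (2 * n * j) > 0 \<longleftrightarrow> even (t (2 * n * j + 1)) then t (2 * n * j + 1) else t (2 * n * j))"
      by (simp_all add: profile_of_parts_def)
    show "R (2 * n * j) + R (2 * n * j + 1) = t (2 * n * j) + t (2 * n * j + 1)"
      unfolding R by simp
    have "t (2 * n * j) = nat \<bar>h (2 * n * j)\<bar> + t (2 * n * j + 1)"
      using tail_Suc[OF fin_h, of "2 * n * j"] by simp
    then have "odd (t (2 * n * j)) \<longleftrightarrow> odd (h (2 * n * j)) \<noteq> odd (t (2 * n * j + 1))"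
      by (simp add: even_nat_iff)
    then show "- of_bool (odd (R (2 * n * j))) + of_bool (odd (R (2 * n * j + 1))) =
      - (if odd (h (2 * n * j)) then sgn (h (2 * n * j)) else 0 :: int)"
      unfolding R by (auto simp: sgn_if)
  qed
  show "cont n (wall_of n R) 0 + cont n (wall_of n R) 1 = color_count n h J 1"
  proof (cases "J = 0")
    case True
    then show ?thesis
      by (simp add: cont_eq color_count_def)
  next
    case False
    let ?F = "\<lambda>a. if a mod (2 * n) = 0 \<or> a mod (2 * n) = 1 then R a else 0"
    \<comment> \<open>The ground blocks are not part of the content, so level \<open>0\<close> is split off from the sum over all levels.\<close>
    have "R 0 + (cont n (wall_of n R) 0 + cont n (wall_of n R) 1) = ?F 0 + (\<Sum>a\<in>{1..<2 * n * J}. ?F a)"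
      unfolding cont_eq sum.distrib[symmetric] S by simp
    also have "\<dots> = (\<Sum>a<2 * n * J. ?F a)"
      using False n by (intro sum_without_0[symmetric]) simp
    also have "\<dots> = (\<Sum>j<J. ?F (2 * n * j + 0) + ?F (2 * n * j + 1))"
      using n by (intro sum_two_residues) auto
    also have "\<dots> = (\<Sum>j<J. R (2 * n * j) + R (2 * n * j + 1))"
      using n by (intro sum.cong) (auto simp: mod_Suc)
    also have "\<dots> = (\<Sum>j<J. t (2 * n * j)) + (\<Sum>j<J. t (2 * n * j + 1))"
      unfolding pair by (rule sum.distrib)
    finally have 1: "t 0 + (cont n (wall_of n R) 0 + cont n (wall_of n R) 1) =
        (\<Sum>j<J. t (2 * n * j)) + (\<Sum>j<J. t (2 * n * j + 1))"
      unfolding R0 .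
    have "(\<Sum>j<J. t (2 * n * j)) = (\<Sum>j<Suc J. t (2 * n * j))"
      using tail_bound[of "2 * n * J"] by simp
    also have "\<dots> = t 0 + (\<Sum>j<J. t (2 * n * Suc j))"
      by (subst sum.lessThan_Suc_shift) simp
    finally have 2: "(\<Sum>j<J. t (2 * n * j)) = t 0 + (\<Sum>j<J. t (2 * n * Suc j))" .
    have "color_count n h J 1 = (\<Sum>j<J. t (2 * n * j + 1)) + (\<Sum>j<J. t (2 * n * Suc j))"
      by (simp add: color_count_def sum.distrib add.commute)
    with 1 2 show ?thesis
      by linarith
  qed
  show "int (cont n (wall_of n R) 0) - int (cont n (wall_of n R) 1) =
     of_bool (odd (t 0)) - charge (\<lambda>j. h (2 * n * Suc j))"
  proof (cases "J = 0")
    case True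
    have "cont n (wall_of n R) i = 0" for i
      unfolding cont_eq True by simp
    moreover have "charge (\<lambda>j. h (2 * n * Suc j)) = 0"
      unfolding charge_conv_sum[symmetric] True by simp
    moreover have "t 0 = 0"
      using tail_bound[of 0] True by simp
    ultimately show ?thesis
      by simp
  next
    case False
    have "?D 0 + (int (cont n (wall_of n R) 0) - int (cont n (wall_of n R) 1)) =
        ?D 0 + (\<Sum>a\<in>{1..<2 * n * J}. ?D a)"
      unfolding cont_eq of_nat_sum sum_subtractf[symmetric] D ..
    also have "\<dots> = (\<Sum>a<2 * n * J. ?D a)"
      using False n by (intro sum_without_0[symmetric]) simp
    also have "\<dots> = (\<Sum>j<J. ?D (2 * n * j + 0) + ?D (2 * n * j + 1))"
      using n by (intro sum_two_residues) auto
    also have "\<dots> = (\<Sum>j<J. - of_bool (odd (R (2 * n * j))) + of_bool (odd (R (2 * n * j + 1))))"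
      using n by (intro sum.cong) (auto simp: mod_Suc)
    also have "\<dots> = - charge (\<lambda>j. h (2 * n * Suc j))"
      unfolding pair charge_conv_sum[symmetric] by (rule sum_negf)
    finally show ?thesis
      by (simp add: R0)
  qed
qed

text \<open>Modulo \<open>2\<close>, the color \<open>n\<close> occurs only in the parts that are odd multiples of \<open>n\<close>, and the balanced parts
  come in pairs, so the number of parts is congruent to the number of blocks of color \<open>n\<close> plus the
  number of parts divisible by \<open>2n\<close>; the latter is congruent to the charge.\<close>

lemma tail_parity:
  assumes "balanced n h"
  shows "even (int (t 0) + int (total_weight n h) + charge (\<lambda>j. h (2 * n * Suc j)))"
proof -
  let ?H = "\<lambda>b. int (nat \<bar>h b\<bar>)"
  let ?G = "\<lambda>b. int (1 + half_weight n b) * ?H b"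
  let ?g = "\<lambda>j. if odd (h (2 * n * j)) then sgn (h (2 * n * j)) else 0 :: int"
  have "int (t 0) + int (total_weight n h) = (\<Sum>b<2 * n * J. ?G b)"
    unfolding tail_conv_sum total_weight_eq
    by (simp add: atLeast0LessThan distrib_right sum.distrib)
  also have "\<dots> = (\<Sum>j<J. ?G (2 * n * j)) + (\<Sum>j<J. ?G (2 * n * j + n)) +
      (\<Sum>i\<in>{1..<n}. \<Sum>j<J. ?G (2 * n * j + i) + ?G (2 * n * j + (2 * n - i)))"
    using n by (intro sum_paired_residues) simp
  finally have "int (t 0) + int (total_weight n h) + charge (\<lambda>j. h (2 * n * Suc j)) =
      (\<Sum>j<J. ?G (2 * n * j) + ?g j) + (\<Sum>j<J. ?G (2 * n * j + n)) +
      (\<Sum>i\<in>{1..<n}. \<Sum>j<J. ?G (2 * n * j + i) + ?G (2 * n * j + (2 * n - i)))"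
    unfolding charge_conv_sum[symmetric] sum.distrib by simp
  moreover have "even (\<Sum>j<J. ?G (2 * n * j) + ?g j)"
  proof (rule dvd_sum)
    fix j
    have "half_weight n (2 * n * j) = 2 * j"
      using half_weight_residue[of 0 j] n by simp
    moreover have "even (?H b) \<longleftrightarrow> even (h b)" for b
      by (simp add: even_nat_iff)
    ultimately show "even (?G (2 * n * j) + ?g j)"
      by (auto simp: sgn_if)
  qed
  moreover have "even (\<Sum>j<J. ?G (2 * n * j + n))"
  proof (rule dvd_sum)
    fix j
    have "half_weight n (2 * n * j + n) = 2 * j + 1"
      using half_weight_residue[of n j] n by simp
    then show "even (?G (2 * n * j + n))"
      by simp
  qed
  moreover have "even (\<Sum>i\<in>{1..<n}. \<Sum>j<J. ?G (2 * n * j + i) + ?G (2 * n * j + (2 * n - i)))"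
  proof (rule dvd_sum)
    fix i assume i: "i \<in> {1..<n}"
    \<comment> \<open>Both weights are even, so modulo \<open>2\<close> only the numbers of parts count, and these are equal.\<close>
    have w: "half_weight n (2 * n * j + i) = 2 * j" "half_weight n (2 * n * j + (2 * n - i)) = 2 * j + 2" for j
      using half_weight_residue[of i j] half_weight_residue[of "2 * n - i" j] i by auto
    have "?G (2 * n * j + i) + ?G (2 * n * j + (2 * n - i)) =
        ?H (2 * n * j + i) + ?H (2 * n * j + (2 * n - i)) +
        2 * (int j * ?H (2 * n * j + i) + int (j + 1) * ?H (2 * n * j + (2 * n - i)))" for j
      unfolding w by (simp add: algebra_simps)
    then have "(\<Sum>j<J. ?G (2 * n * j + i) + ?G (2 * n * j + (2 * n - i))) =
        (\<Sum>j<J. ?H (2 * n * j + i)) + (\<Sum>j<J. ?H (2 * n * j + (2 * n - i))) +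
        2 * (\<Sum>j<J. int j * ?H (2 * n * j + i) + int (j + 1) * ?H (2 * n * j + (2 * n - i)))"
      by (simp only: sum.distrib sum_distrib_left distrib_left)
    also have "(\<Sum>j<J. ?H (2 * n * j + i)) = (\<Sum>j<J. ?H (2 * n * j + (2 * n - i)))"
      unfolding residue_count[OF residue_not_dvd(1)[OF i]] residue_count[OF residue_not_dvd(2)[OF i]]
      using assms i by (simp add: balanced_def)
    finally show "even (\<Sum>j<J. ?G (2 * n * j + i) + ?G (2 * n * j + (2 * n - i)))"
      by simp
  qed
  ultimately show ?thesis
    by simp
qed

lemma total_weight_decomp_bounded:
  "total_weight n h = 2 * mult_weight Suc (\<lambda>j. nat \<bar>h (2 * n * Suc j)\<bar>) +
    (mult_weight (\<lambda>j. 2 * j + 1) (\<lambda>j. nat (h (2 * n * j + n))) +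
     (\<Sum>i\<in>{1..<n}. 2 * pair_weight ({j. h (2 * n * j + i) \<noteq> 0}, {j. h (2 * n * j + (2 * n - i)) \<noteq> 0})))"
proof -
  let ?G = "\<lambda>b. half_weight n b * nat \<bar>h b\<bar>"
  have "total_weight n h = (\<Sum>j<J. ?G (2 * n * j)) + (\<Sum>j<J. ?G (2 * n * j + n)) +
      (\<Sum>i\<in>{1..<n}. \<Sum>j<J. ?G (2 * n * j + i) + ?G (2 * n * j + (2 * n - i)))"
    unfolding total_weight_eq using n by (intro sum_paired_residues) simp
  moreover have "(\<Sum>j<J. ?G (2 * n * j)) = 2 * mult_weight Suc (\<lambda>j. nat \<bar>h (2 * n * Suc j)\<bar>)"
  proof -
    have w: "half_weight n (2 * n * j) = 2 * j" for j
      using half_weight_residue[of 0 j] n by simp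
    have "(\<Sum>j<J. ?G (2 * n * j)) = (\<Sum>j<Suc J. 2 * j * nat \<bar>h (2 * n * j)\<bar>)"
      using J[of "2 * n * J"] by (simp add: w)
    also have "\<dots> = 2 * (\<Sum>j<J. Suc j * nat \<bar>h (2 * n * Suc j)\<bar>)"
      by (subst sum.lessThan_Suc_shift) (simp add: sum_distrib_left mult.assoc del: mult_Suc mult_Suc_right)
    also have "(\<Sum>j<J. Suc j * nat \<bar>h (2 * n * Suc j)\<bar>) = mult_weight Suc (\<lambda>j. nat \<bar>h (2 * n * Suc j)\<bar>)"
    proof (rule mult_weight_eq[symmetric])
      fix j assume "j \<notin> {..<J}"
      then have "2 * n * J \<le> 2 * n * Suc j"
        by (intro mult_le_mono2) simp
      then show "nat \<bar>h (2 * n * Suc j)\<bar> = 0"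
        using J by simp
    qed simp
    finally show ?thesis .
  qed
  moreover have "(\<Sum>j<J. ?G (2 * n * j + n)) = mult_weight (\<lambda>j. 2 * j + 1) (\<lambda>j. nat (h (2 * n * j + n)))"
  proof -
    have "\<not> 2 * n dvd 2 * n * j + n" for j
      using n by (auto simp: dvd_add_right_iff dest: dvd_imp_le)
    then have "h (2 * n * j + n) \<ge> 0" for j
      using h by (simp add: signed_parts_def)
    then have "nat \<bar>h (2 * n * j + n)\<bar> = nat (h (2 * n * j + n))" for j
      by simp
    moreover have "half_weight n (2 * n * j + n) = 2 * j + 1" for j
      using half_weight_residue[of n j] n by simp
    ultimately have "(\<Sum>j<J. ?G (2 * n * j + n)) = (\<Sum>j<J. (2 * j + 1) * nat (h (2 * n * j + n)))"
      by simp
    also have "\<dots> = mult_weight (\<lambda>j. 2 * j + 1) (\<lambda>j. nat (h (2 * n * j + n)))"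
    proof (rule mult_weight_eq[symmetric])
      fix j assume "j \<notin> {..<J}"
      then have "h (2 * n * j + n) = 0"
        using residue_bound[of n] by blast
      then show "nat (h (2 * n * j + n)) = 0"
        by simp
    qed simp
    finally show ?thesis .
  qed
  moreover have "(\<Sum>j<J. ?G (2 * n * j + i) + ?G (2 * n * j + (2 * n - i))) =
      2 * pair_weight ({j. h (2 * n * j + i) \<noteq> 0}, {j. h (2 * n * j + (2 * n - i)) \<noteq> 0})"
    if i: "i \<in> {1..<n}" for i
  proof -
    have w: "half_weight n (2 * n * j + i) = 2 * j" "half_weight n (2 * n * j + (2 * n - i)) = 2 * j + 2" for j
      using half_weight_residue[of i j] half_weight_residue[of "2 * n - i" j] i by auto
    have "(\<Sum>j<J. ?G (2 * n * j + i) + ?G (2 * n * j + (2 * n - i))) =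
        (\<Sum>j | h (2 * n * j + i) \<noteq> 0. 2 * j) + (\<Sum>j | h (2 * n * j + (2 * n - i)) \<noteq> 0. 2 * j + 2)"
      using residue_sum[OF residue_not_dvd(1)[OF i], of "\<lambda>j. 2 * j"]
        residue_sum[OF residue_not_dvd(2)[OF i], of "\<lambda>j. 2 * j + 2"]
      by (simp only: w sum.distrib of_nat_id)
    also have "\<dots> = 2 * pair_weight ({j. h (2 * n * j + i) \<noteq> 0}, {j. h (2 * n * j + (2 * n - i)) \<noteq> 0})"
      by (simp only: pair_weight_def prod.case sum.distrib sum_distrib_left[symmetric]) simp
    finally show ?thesis .
  qed
  ultimately show ?thesis
    by simp
qed

text \<open>Each of the colors \<open>2, \<dots>, n\<close> occurs as often as the colors \<open>0\<close> and \<open>1\<close> together if and only if \<open>h\<close>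
  is balanced.  The excess of the color \<open>0\<close> over the color \<open>1\<close> has to be \<open>1\<close>: the charge is then \<open>0\<close> or \<open>-1\<close>, depending on the
  parity of the number of parts.  Conversely this parity is determined by the charge, because there is
  an odd number of blocks of color \<open>n\<close>, and both values of the charge give the excess \<open>1\<close>.\<close>

lemma content_iff_bounded:
  "(\<forall>i. cont n (wall_of n R) i = gamma n i + m * delta n i) \<longleftrightarrow>
    balanced n h \<and> charge (\<lambda>j. h (2 * n * Suc j)) \<in> {0, -1} \<and> total_weight n h = 2 * m + 1"
proof -
  let ?c = "color_count n h J" and ?C = "cont n (wall_of n R)" and ?S = "charge (\<lambda>j. h (2 * n * Suc j))"
  have "(\<forall>i. ?C i = gamma n i + m * delta n i) \<longleftrightarrow>
      ?C 0 = m + 1 \<and> ?C 1 = m \<and> (\<forall>i\<in>{2..n}. ?C i = 2 * m + 1)"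
  proof (intro iffI conjI ballI allI)
    fix i assume *: "?C 0 = m + 1 \<and> ?C 1 = m \<and> (\<forall>i\<in>{2..n}. ?C i = 2 * m + 1)"
    consider "i = 0" | "i = 1" | "i \<in> {2..n}" | "i > n"
      by force
    then show "?C i = gamma n i + m * delta n i"
      using * cont_large n by cases (auto simp: gamma_def delta_def)
  qed (use n in \<open>auto simp: gamma_def delta_def\<close>)
  also have "\<dots> \<longleftrightarrow> (\<forall>i\<in>{1..n}. ?c i = 2 * m + 1) \<and> int (?C 0) - int (?C 1) = 1"
  proof -
    have "{1..n} = insert 1 {2..n}"
      using n by auto
    then have "(\<forall>i\<in>{1..n}. ?c i = 2 * m + 1) \<longleftrightarrow> ?C 0 + ?C 1 = 2 * m + 1 \<and> (\<forall>i\<in>{2..n}. ?C i = 2 * m + 1)"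
      using cont_01(1) cont_middle by simp
    moreover have "?C 0 = m + 1 \<and> ?C 1 = m \<longleftrightarrow> ?C 0 + ?C 1 = 2 * m + 1 \<and> int (?C 0) - int (?C 1) = 1"
      by linarith
    ultimately show ?thesis
      by blast
  qed
  also have "(\<forall>i\<in>{1..n}. ?c i = 2 * m + 1) \<longleftrightarrow> balanced n h \<and> total_weight n h = 2 * m + 1"
  proof -
    have bal: "balanced n h \<longleftrightarrow> (\<forall>i\<in>{1..<n}. ?c i = ?c (Suc i))"
      unfolding balanced_def
    proof (rule ball_cong)
      fix i assume "i \<in> {1..<n}"
      from color_count_diff[OF this]
      show "card {j. h (2 * n * j + i) \<noteq> 0} = card {j. h (2 * n * j + (2 * n - i)) \<noteq> 0} \<longleftrightarrow> ?c i = ?c (Suc i)"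
        by linarith
    qed simp
    have "?c i = ?c n" if *: "\<forall>i\<in>{1..<n}. ?c i = ?c (Suc i)" and i: "1 \<le> i" "i \<le> n" for i
      using i(2,1)
    proof (induction rule: inc_induct)
      case (step k)
      then show ?case
        using * by simp
    qed simp
    then show ?thesis
      unfolding bal color_count_n[symmetric] using n by fastforce
  qed
  also have "(balanced n h \<and> total_weight n h = 2 * m + 1) \<and> int (?C 0) - int (?C 1) = 1 \<longleftrightarrow>
      balanced n h \<and> ?S \<in> {0, -1} \<and> total_weight n h = 2 * m + 1"
  proof -
    have "of_bool (odd (t 0)) - ?S = 1 \<longleftrightarrow> ?S \<in> {0, -1}"
      if bal: "balanced n h" and w: "total_weight n h = 2 * m + 1"
    proof -
      have "odd (t 0) \<longleftrightarrow> even ?S"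
        using tail_parity[OF bal] w by simp
      then show ?thesis
        by (cases "even ?S") auto
    qed
    then show ?thesis
      unfolding cont_01(2) by blast
  qed
  finally show ?thesis .
qed

end

lemma total_weight_decomp:
  assumes h: "h \<in> signed_parts n"
  shows "total_weight n h = 2 * mult_weight Suc (\<lambda>j. nat \<bar>h (2 * n * Suc j)\<bar>) +
    (mult_weight (\<lambda>j. 2 * j + 1) (\<lambda>j. nat (h (2 * n * j + n))) +
     (\<Sum>i\<in>{1..<n}. 2 * pair_weight ({j. h (2 * n * j + i) \<noteq> 0}, {j. h (2 * n * j + (2 * n - i)) \<noteq> 0})))"
proof -
  obtain J where J: "\<And>b. b \<ge> 2 * n * J \<Longrightarrow> h b = 0"
    using parts_bound[OF n h] by blast
  show ?thesis
    by (rule total_weight_decomp_bounded[OF h J])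
qed

lemma content_iff:
  assumes h: "h \<in> signed_parts n"
  shows "wall_of n (profile_of_parts n h) \<in> Z_Lambda1 n m \<longleftrightarrow>
    balanced n h \<and> charge (\<lambda>j. h (2 * n * Suc j)) \<in> {0, -1} \<and> total_weight n h = 2 * m + 1"
proof -
  obtain J where J: "\<And>b. b \<ge> 2 * n * J \<Longrightarrow> h b = 0"
    using parts_bound[OF n h] by blast
  have "profile_of_parts n h \<in> proper_profiles n"
    using bij_betwE[OF bij_betw_profile_of_parts[OF n]] h by blast
  then have "proper_wall n (wall_of n (profile_of_parts n h))"
    using bij_betwE[OF bij_betw_wall_of[OF n]] by blast
  then show ?thesis
    using content_iff_bounded[of h J m, OF h J] by (simp add: Z_Lambda1_def)
qed

lemma card_Z_Lambda1:
  "card (Z_Lambda1 n m) = card {h \<in> signed_parts n. balanced n h \<and>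
     charge (\<lambda>j. h (2 * n * Suc j)) \<in> {0, -1} \<and> total_weight n h = 2 * m + 1}"
proof -
  have bij: "bij_betw (wall_of n \<circ> profile_of_parts n) (signed_parts n) {Y. proper_wall n Y}"
    using bij_betw_profile_of_parts[OF n] bij_betw_wall_of[OF n] by (rule bij_betw_trans)
  let ?A = "{h \<in> signed_parts n. balanced n h \<and>
     charge (\<lambda>j. h (2 * n * Suc j)) \<in> {0, -1} \<and> total_weight n h = 2 * m + 1}"
  have eq: "Z_Lambda1 n m = (wall_of n \<circ> profile_of_parts n) ` ?A"
  proof (intro equalityI subsetI)
    fix Y assume Y: "Y \<in> Z_Lambda1 n m"
    then have "Y \<in> (wall_of n \<circ> profile_of_parts n) ` signed_parts n"
      using bij by (auto simp: Z_Lambda1_def bij_betw_def)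
    then obtain h where "h \<in> signed_parts n" "Y = wall_of n (profile_of_parts n h)"
      by auto
    with Y show "Y \<in> (wall_of n \<circ> profile_of_parts n) ` ?A"
      using content_iff[of h m] by auto
  qed (use content_iff in auto)
  have "inj_on (wall_of n \<circ> profile_of_parts n) ?A"
    by (rule inj_on_subset[OF bij_betw_imp_inj_on[OF bij]]) auto
  then show ?thesis
    unfolding eq by (rule card_image)
qed

end

section \<open>The generating function of the admissible multiplicities\<close>

definition admissible :: "nat \<Rightarrow> (nat \<Rightarrow> int) set" where
  "admissible n = {h \<in> signed_parts n. balanced n h \<and> charge (\<lambda>j. h (2 * n * Suc j)) \<in> {0, -1}}"

text \<open>The three components are the multiplicities of the sizes \<open>2nj\<close> with \<open>j \<ge> 1\<close>, those of the odd multiples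
  of \<open>n\<close>, and, for each \<open>i\<close>, the sets of the parts congruent to \<open>i\<close> and to \<open>-i\<close> modulo \<open>2n\<close>.\<close>

definition split_parts :: "nat \<Rightarrow> (nat \<Rightarrow> int) \<Rightarrow>
    (nat \<Rightarrow> int) \<times> (nat \<Rightarrow> nat) \<times> (nat \<Rightarrow> nat set \<times> nat set)" where
  "split_parts n h = (\<lambda>j. h (2 * n * Suc j), \<lambda>j. nat (h (2 * n * j + n)),
     \<lambda>i\<in>{1..<n}. ({j. h (2 * n * j + i) \<noteq> 0}, {j. h (2 * n * j + (2 * n - i)) \<noteq> 0}))"

definition join_parts :: "nat \<Rightarrow>
    (nat \<Rightarrow> int) \<times> (nat \<Rightarrow> nat) \<times> (nat \<Rightarrow> nat set \<times> nat set) \<Rightarrow> nat \<Rightarrow> int" where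
  "join_parts n = (\<lambda>(v, \<mu>, p) b.
     (let j = b div (2 * n); r = b mod (2 * n) in
       if r = 0 then if j = 0 then 0 else v (j - 1)
       else if r = n then int (\<mu> j)
       else if r < n then of_bool (j \<in> fst (p r))
       else of_bool (j \<in> snd (p (2 * n - r)))))"

lemma finite_residue:
  fixes n r :: nat
  assumes "finite {b. h b \<noteq> (0 :: int)}" "n > 0"
  shows "finite {j. h (2 * n * j + r) \<noteq> 0}"
proof -
  have "inj (\<lambda>j. 2 * n * j + r)"
    using assms(2) by (auto intro: injI)
  then have "finite ((\<lambda>j. 2 * n * j + r) -` {b. h b \<noteq> 0})"
    using assms(1) by (intro finite_vimageI)
  then show ?thesis
    by (simp add: vimage_def)
qed

context
  fixes n :: nat
  assumes n: "n \<ge> 3"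
begin

lemma join_parts_residue:
  assumes "r < 2 * n"
  shows "join_parts n (v, \<mu>, p) (2 * n * j + r) =
    (if r = 0 then if j = 0 then 0 else v (j - 1)
     else if r = n then int (\<mu> j)
     else if r < n then of_bool (j \<in> fst (p r))
     else of_bool (j \<in> snd (p (2 * n - r))))"
  using assms n by (simp add: join_parts_def Let_def)

lemma join_parts_values:
  "join_parts n (v, \<mu>, p) (2 * n * Suc j) = v j"
  "join_parts n (v, \<mu>, p) (2 * n * j + n) = int (\<mu> j)"
  "i \<in> {1..<n} \<Longrightarrow> join_parts n (v, \<mu>, p) (2 * n * j + i) = of_bool (j \<in> fst (p i))"
  "i \<in> {1..<n} \<Longrightarrow> join_parts n (v, \<mu>, p) (2 * n * j + (2 * n - i)) = of_bool (j \<in> snd (p i))"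
  using n join_parts_residue[of 0 v \<mu> p "Suc j"] join_parts_residue[of n v \<mu> p j]
    join_parts_residue[of i v \<mu> p j] join_parts_residue[of "2 * n - i" v \<mu> p j]
  by (auto simp del: mult_Suc_right)

lemma join_parts_admissible:
  assumes v: "v \<in> signed_mults" and \<mu>: "\<mu> \<in> mults" and p: "p \<in> {1..<n} \<rightarrow>\<^sub>E balanced_pairs"
  shows "join_parts n (v, \<mu>, p) \<in> admissible n"
proof -
  let ?h = "join_parts n (v, \<mu>, p)"
  let ?J = "Suc ` {j. v j \<noteq> 0} \<union> {j. \<mu> j \<noteq> 0} \<union> (\<Union>i\<in>{1..<n}. fst (p i) \<union> snd (p i))"
  have pi: "finite (fst (p i))" "finite (snd (p i))" "card (fst (p i)) = card (snd (p i))"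
    if "i \<in> {1..<n}" for i
  proof -
    have "p i \<in> balanced_pairs"
      using p that by blast
    then show "finite (fst (p i))" "finite (snd (p i))" "card (fst (p i)) = card (snd (p i))"
      by (auto simp: balanced_pairs_def)
  qed
  have finJ: "finite ?J"
    using v \<mu> pi by (auto simp: signed_mults_def mults_def)
  have decomp: "b = 2 * n * (b div (2 * n)) + b mod (2 * n)" for b
    by simp
  have mod: "b mod (2 * n) < 2 * n" for b
    using n by simp
  have "{b. ?h b \<noteq> 0} \<subseteq> (\<lambda>(j, r). 2 * n * j + r) ` (?J \<times> {..<2 * n})"
  proof
    fix b assume b: "b \<in> {b. ?h b \<noteq> 0}"
    define j r where "j = b div (2 * n)" and "r = b mod (2 * n)"
    have br: "b = 2 * n * j + r" "r < 2 * n"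
      using decomp[of b] mod[of b] by (simp_all add: j_def r_def)
    have "j \<in> ?J"
    proof (cases "r = 0 \<or> r = n")
      case True
      then show ?thesis
        using b unfolding br(1) mem_Collect_eq join_parts_residue[OF br(2)]
        by (cases j) (auto split: if_splits)
    next
      case False
      then show ?thesis
      proof (cases "r < n")
        case True
        then have "r \<in> {1..<n}" "j \<in> fst (p r)"
          using b False unfolding br(1) mem_Collect_eq join_parts_residue[OF br(2)] by auto
        then show ?thesis
          by blast
      next
        case nless: False
        then have "2 * n - r \<in> {1..<n}" "j \<in> snd (p (2 * n - r))"
          using b br(2) False unfolding br(1) mem_Collect_eq join_parts_residue[OF br(2)] by auto
        then show ?thesis
          by blast
      qed
    qed
    then show "b \<in> (\<lambda>(j, r). 2 * n * j + r) ` (?J \<times> {..<2 * n})"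
      using br by (intro image_eqI[of _ _ "(j, r)"]) auto
  qed
  then have "finite {b. ?h b \<noteq> 0}"
    by (rule finite_subset) (use finJ in blast)
  moreover have "?h 0 = 0"
    using join_parts_residue[of 0 v \<mu> p 0] n by simp
  moreover have "?h b \<ge> 0" if "\<not> 2 * n dvd b" for b
    using that by (auto simp: join_parts_def Let_def dvd_eq_mod_eq_0)
  moreover have "?h b \<le> 1" if "\<not> n dvd b" for b
  proof -
    have "b mod (2 * n) mod n \<noteq> 0"
      using that by (simp add: mod_mod_cancel dvd_eq_mod_eq_0)
    then have "b mod (2 * n) \<noteq> 0" "b mod (2 * n) \<noteq> n"
      by (metis mod_0, metis mod_self)
    then show ?thesis
      by (auto simp: join_parts_def Let_def)
  qed
  moreover have "balanced n ?h"
    unfolding balanced_def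
  proof
    fix i assume i: "i \<in> {1..<n}"
    show "card {j. ?h (2 * n * j + i) \<noteq> 0} = card {j. ?h (2 * n * j + (2 * n - i)) \<noteq> 0}"
      unfolding join_parts_values(3)[OF i] join_parts_values(4)[OF i] using pi(3)[OF i] by simp
  qed
  moreover have "charge (\<lambda>j. ?h (2 * n * Suc j)) \<in> {0, -1}"
    unfolding join_parts_values(1) using v by (simp add: signed_mults_def)
  ultimately show ?thesis
    by (simp add: admissible_def signed_parts_def)
qed

lemma split_parts_mem:
  assumes h: "h \<in> admissible n"
  shows "split_parts n h \<in> signed_mults \<times> (mults \<times> ({1..<n} \<rightarrow>\<^sub>E balanced_pairs))"
proof -
  have fin: "finite {b. h b \<noteq> 0}"
    using h by (simp add: admissible_def signed_parts_def)
  have n0: "n > 0"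
    using n by simp
  have "(\<lambda>j. h (2 * n * Suc j)) \<in> signed_mults"
    using finite_residue[OF fin n0, of "2 * n"] h
    by (simp add: signed_mults_def admissible_def add.commute)
  moreover have "(\<lambda>j. nat (h (2 * n * j + n))) \<in> mults"
    unfolding mults_def mem_Collect_eq
    by (rule finite_subset[OF _ finite_residue[OF fin n0, of n]]) auto
  moreover have "({j. h (2 * n * j + i) \<noteq> 0}, {j. h (2 * n * j + (2 * n - i)) \<noteq> 0}) \<in> balanced_pairs"
    if "i \<in> {1..<n}" for i
    using finite_residue[OF fin n0, of i] finite_residue[OF fin n0, of "2 * n - i"] h that
    by (simp add: balanced_pairs_def admissible_def balanced_def)
  ultimately show ?thesis
    by (simp add: split_parts_def)
qed

lemma join_split_parts:
  assumes h: "h \<in> admissible n"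
  shows "join_parts n (split_parts n h) = h"
proof
  fix b
  define j r where "j = b div (2 * n)" and "r = b mod (2 * n)"
  have br: "b = 2 * n * j + r" "r < 2 * n"
    using n by (simp_all add: j_def r_def)
  have sp: "h \<in> signed_parts n"
    using h by (simp add: admissible_def)
  have nonneg: "h (2 * n * j + r) \<ge> 0" if "r \<noteq> 0"
  proof -
    have "\<not> 2 * n dvd 2 * n * j + r"
      using that br(2) by (auto simp: dvd_add_right_iff dest: dvd_imp_le)
    then show ?thesis
      using sp by (simp add: signed_parts_def)
  qed
  have small: "h (2 * n * j + r) \<le> 1" if "r \<noteq> 0" "r \<noteq> n"
  proof -
    have "\<not> n dvd r"
      using that br(2) by (auto elim!: dvdE simp: less_2_cases_iff)
    moreover have "n dvd 2 * n * j"
      by simp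
    ultimately have "\<not> n dvd 2 * n * j + r"
      using dvd_add_right_iff by blast
    then show ?thesis
      using sp by (simp add: signed_parts_def)
  qed
  have h0: "h 0 = 0"
    using sp by (simp add: signed_parts_def)
  consider "r = 0" "j = 0" | k where "r = 0" "j = Suc k" | "r = n"
    | "r \<in> {1..<n}" | "2 * n - r \<in> {1..<n}" "r > n"
  proof (cases "r = 0")
    case True
    then show ?thesis
      using that(1,2) by (cases j) auto
  next
    case r0: False
    consider "r < n" | "r = n" | "r > n"
      by linarith
    then show ?thesis
    proof cases
      case 3
      then have "2 * n - r \<in> {1..<n}"
        using br(2) by auto
      then show ?thesis
        using that(5) 3 by blast
    qed (use that(3,4) r0 in auto)
  qed
  then show "join_parts n (split_parts n h) b = h b"
  proof cases
    case 1
    then show ?thesis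
      using h0 br join_parts_residue[of 0 _ _ _ 0] n by (simp add: split_parts_def)
  next
    case 2
    then have b: "b = 2 * n * Suc k"
      using br(1) by simp
    show ?thesis
      unfolding b split_parts_def join_parts_values(1) ..
  next
    case 3
    then show ?thesis
      unfolding br(1) split_parts_def using nonneg n by (simp add: join_parts_values(2))
  next
    case 4
    then have "h (2 * n * j + r) = of_bool (h (2 * n * j + r) \<noteq> 0)"
      using nonneg small by force
    then show ?thesis
      unfolding br(1) split_parts_def join_parts_values(3)[OF 4] restrict_apply'[OF 4] by simp
  next
    case 5
    then have "h (2 * n * j + r) = of_bool (h (2 * n * j + r) \<noteq> 0)"
      using nonneg small by force
    moreover define i where "i = 2 * n - r"
    have i: "i \<in> {1..<n}"
      using 5(1) by (simp only: i_def)
    have r: "r = 2 * n - i"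
      using br(2) by (simp add: i_def)
    ultimately show ?thesis
      unfolding br(1) split_parts_def r join_parts_values(4)[OF i] restrict_apply'[OF i] by simp
  qed
qed

lemma split_join_parts:
  assumes p: "p \<in> {1..<n} \<rightarrow>\<^sub>E balanced_pairs"
  shows "split_parts n (join_parts n (v, \<mu>, p)) = (v, \<mu>, p)"
proof -
  have "(\<lambda>i\<in>{1..<n}. ({j. join_parts n (v, \<mu>, p) (2 * n * j + i) \<noteq> 0},
      {j. join_parts n (v, \<mu>, p) (2 * n * j + (2 * n - i)) \<noteq> 0})) = p"
  proof
    fix i
    show "(\<lambda>i\<in>{1..<n}. ({j. join_parts n (v, \<mu>, p) (2 * n * j + i) \<noteq> 0},
      {j. join_parts n (v, \<mu>, p) (2 * n * j + (2 * n - i)) \<noteq> 0})) i = p i"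
    proof (cases "i \<in> {1..<n}")
      case True
      then show ?thesis
        unfolding restrict_apply'[OF True] join_parts_values(3)[OF True] join_parts_values(4)[OF True]
        by simp
    next
      case False
      then show ?thesis
        unfolding restrict_def if_not_P[OF False] using PiE_arb[OF p False] by simp
    qed
  qed
  then show ?thesis
    unfolding split_parts_def join_parts_values by simp
qed

text \<open>The total weight is additive over the components of \<open>split_parts\<close>, and the conditions on \<open>h\<close> concern one
  component each.  Hence the generating function is a product.\<close>

lemma has_gf_admissible:
  obtains F where "has_gf (admissible n) (total_weight n) F"
    "F * (euler (\<lambda>j. 2 * Suc j) * euler (\<lambda>j. 4 * Suc j) * euler (\<lambda>j. 2 * j + 1) *
       euler (\<lambda>j. 2 * Suc j) ^ (n - 1)) = 1"
proof -
  obtain G1 where G1: "has_gf signed_mults (\<lambda>v. 2 * mult_weight Suc (\<lambda>j. nat \<bar>v j\<bar>)) G1"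
    "G1 * (euler (\<lambda>j. 2 * Suc j) * euler (\<lambda>j. 2 * 2 * Suc j)) = 1"
    using has_gf_signed_mults[of 2] by auto
  obtain G2 where G2: "has_gf mults (mult_weight (\<lambda>j. 2 * j + 1)) G2"
    "G2 * euler (\<lambda>j. 2 * j + 1) = 1"
    using has_gf_mults[of "\<lambda>j. 2 * j + 1"] by auto
  obtain G3 where G3: "has_gf balanced_pairs (\<lambda>p. 2 * pair_weight p) G3"
    "G3 * euler (\<lambda>j. 2 * Suc j) = 1"
    using has_gf_balanced_pairs[of 2] by auto
  let ?F = "G1 * (G2 * G3 ^ card {1..<n})"
  have "has_gf (admissible n) (total_weight n) ?F"
  proof (rule has_gf_bij[OF _ _ has_gf_times[OF G1(1) has_gf_times[OF G2(1) has_gf_power[OF _ G3(1)]]]])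
    show "bij_betw (join_parts n) (signed_mults \<times> (mults \<times> ({1..<n} \<rightarrow>\<^sub>E balanced_pairs))) (admissible n)"
    proof (rule bij_betw_byWitness[where f' = "split_parts n"]; intro ballI image_subsetI)
      fix a assume a: "a \<in> signed_mults \<times> (mults \<times> ({1..<n} \<rightarrow>\<^sub>E balanced_pairs))"
      obtain v \<mu> p where eq: "a = (v, \<mu>, p)"
        by (metis surj_pair)
      show "split_parts n (join_parts n a) = a" "join_parts n a \<in> admissible n"
        using a split_join_parts[of p v \<mu>] join_parts_admissible[of v \<mu> p] by (simp_all add: eq)
    qed (rule join_split_parts split_parts_mem, assumption)+
  next
    fix a assume a: "a \<in> signed_mults \<times> (mults \<times> ({1..<n} \<rightarrow>\<^sub>E balanced_pairs))"
    obtain v \<mu> p where eq: "a = (v, \<mu>, p)"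
      by (metis surj_pair)
    have "join_parts n a \<in> signed_parts n"
      using join_parts_admissible[of v \<mu> p] a by (simp add: eq admissible_def)
    note total_weight_decomp[OF n this]
    moreover have "(\<Sum>i\<in>{1..<n}. 2 * pair_weight ({j. join_parts n a (2 * n * j + i) \<noteq> 0},
        {j. join_parts n a (2 * n * j + (2 * n - i)) \<noteq> 0})) = (\<Sum>i\<in>{1..<n}. 2 * pair_weight (p i))"
    proof (rule sum.cong)
      fix i assume i: "i \<in> {1..<n}"
      show "2 * pair_weight ({j. join_parts n a (2 * n * j + i) \<noteq> 0},
          {j. join_parts n a (2 * n * j + (2 * n - i)) \<noteq> 0}) = 2 * pair_weight (p i)"
        unfolding eq join_parts_values(3)[OF i] join_parts_values(4)[OF i] by simp
    qed simp
    ultimately show "total_weight n (join_parts n a) =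
        (case a of (a, b) \<Rightarrow> 2 * mult_weight Suc (\<lambda>j. nat \<bar>a j\<bar>) +
          (case b of (a, b) \<Rightarrow> mult_weight (\<lambda>j. 2 * j + 1) a + (\<Sum>i\<in>{1..<n}. 2 * pair_weight (b i))))"
      unfolding eq by (simp add: join_parts_values(1,2) del: mult_Suc_right)
  qed simp
  moreover have "?F * (euler (\<lambda>j. 2 * Suc j) * euler (\<lambda>j. 4 * Suc j) * euler (\<lambda>j. 2 * j + 1) *
       euler (\<lambda>j. 2 * Suc j) ^ (n - 1)) = 1"
  proof -
    have "?F * (euler (\<lambda>j. 2 * Suc j) * euler (\<lambda>j. 4 * Suc j) * euler (\<lambda>j. 2 * j + 1) *
       euler (\<lambda>j. 2 * Suc j) ^ (n - 1)) = (G1 * (euler (\<lambda>j. 2 * Suc j) * euler (\<lambda>j. 2 * 2 * Suc j))) *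
       (G2 * euler (\<lambda>j. 2 * j + 1)) * (G3 * euler (\<lambda>j. 2 * Suc j)) ^ (n - 1)"
      by (simp add: power_mult_distrib mult_ac del: mult_Suc_right)
    then show ?thesis
      by (simp only: G1(2) G2(2) G3(2) power_one mult_1_left)
  qed
  ultimately show ?thesis
    by (rule that)
qed

end

section \<open>The substitution of \<open>-X\<close> for \<open>X\<close> and the string function\<close>

text \<open>The positive integers are split into the odd and the even ones.\<close>

lemma euler_dissect:
  assumes "a > 0"
  shows "euler (\<lambda>j. a * Suc j) = euler (\<lambda>j. a * (2 * j + 1)) * euler (\<lambda>j. 2 * a * Suc j)"
proof -
  have c: "a * Suc j > j" "a * (2 * j + 1) > j" "2 * a * Suc j > j" for j
    using assms by (cases a; simp)+
  have fin: "(\<Prod>j<2 * N. 1 - fps_X ^ (a * Suc j)) =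
      (\<Prod>j<N. 1 - fps_X ^ (a * (2 * j + 1))) * (\<Prod>j<N. 1 - fps_X ^ (2 * a * Suc j) :: rat fps)" for N
  proof (induction N)
    case (Suc N)
    have two: "(\<Prod>j<2 * Suc N. f j) = (\<Prod>j<2 * N. f j) * f (2 * N) * f (Suc (2 * N))"
      for f :: "nat \<Rightarrow> rat fps"
      by simp
    have exps: "a * Suc (Suc (2 * N)) = 2 * a * Suc N" "a * Suc (2 * N) = a * (2 * N + 1)"
      by simp_all
    show ?case
      unfolding two Suc exps prod.lessThan_Suc by (simp only: mult_ac)
  qed simp
  have "(\<lambda>N. \<Prod>j<2 * N. 1 - fps_X ^ (a * Suc j) :: rat fps) \<longlonglongrightarrow> euler (\<lambda>j. a * Suc j)"
    using LIMSEQ_subseq_LIMSEQ[OF euler_tendsto(1)[OF c(1)], of "\<lambda>N. 2 * N"]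
    by (simp add: strict_mono_def o_def)
  moreover have "(\<lambda>N. (\<Prod>j<N. 1 - fps_X ^ (a * (2 * j + 1))) * (\<Prod>j<N. 1 - fps_X ^ (2 * a * Suc j) :: rat fps))
      \<longlonglongrightarrow> euler (\<lambda>j. a * (2 * j + 1)) * euler (\<lambda>j. 2 * a * Suc j)"
    by (intro fps_tendsto_mult euler_tendsto(1) c)
  ultimately show ?thesis
    unfolding fin by (rule LIMSEQ_unique)
qed

lemma fps_tendsto_compose_uminus_X:
  fixes F :: "'a::comm_ring_1 fps"
  assumes "f \<longlonglongrightarrow> F"
  shows "(\<lambda>n. f n oo (- fps_X)) \<longlonglongrightarrow> (F oo (- fps_X))"
proof (rule tendsto_fpsI)
  fix m
  have "eventually (\<lambda>n. f n $ m = F $ m) sequentially"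
    using assms by (simp add: tendsto_fps_iff)
  then show "eventually (\<lambda>n. (f n oo (- fps_X)) $ m = (F oo (- fps_X)) $ m) sequentially"
    by eventually_elim (simp add: fps_compose_uminus')
qed

lemma uminus_X_compose_factor:
  "(1 - fps_X ^ k :: rat fps) oo (- fps_X) = 1 - (- fps_X) ^ k"
  by (simp add: fps_compose_sub_distrib flip: fps_compose_power)

lemma euler_even_compose:
  assumes c: "\<And>j. c j > j" "\<And>j. even (c j)"
  shows "euler c oo (- fps_X) = euler c"
proof -
  have "(\<lambda>N. (\<Prod>j<N. 1 - fps_X ^ c j) oo (- fps_X)) \<longlonglongrightarrow> (euler c oo (- fps_X))"
    using fps_tendsto_compose_uminus_X[OF euler_tendsto(1)[OF c(1)]] .
  moreover have "(\<Prod>j<N. 1 - fps_X ^ c j) oo (- fps_X) = (\<Prod>j<N. 1 - fps_X ^ c j :: rat fps)" for N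
    by (simp add: fps_compose_prod_distrib uminus_X_compose_factor c(2))
  ultimately show ?thesis
    using euler_tendsto(1)[OF c(1)] by (metis (lifting) ext LIMSEQ_unique)
qed

text \<open>For odd exponents \<open>(1 - (-X)\<^sup>c)(1 - X\<^sup>c) = 1 - X\<^sup>2\<^sup>c\<close>.\<close>

lemma euler_odd_compose:
  assumes c: "\<And>j. c j > j" "\<And>j. odd (c j)"
  shows "(euler c oo (- fps_X)) * euler c = euler (\<lambda>j. 2 * c j)"
proof -
  have c2: "2 * c j > j" for j
    using c(1)[of j] by simp
  have "(\<lambda>N. ((\<Prod>j<N. 1 - fps_X ^ c j) oo (- fps_X)) * (\<Prod>j<N. 1 - fps_X ^ c j))
      \<longlonglongrightarrow> (euler c oo (- fps_X)) * euler c"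
    by (intro fps_tendsto_mult fps_tendsto_compose_uminus_X euler_tendsto(1) c)
  moreover have "((\<Prod>j<N. 1 - fps_X ^ c j) oo (- fps_X)) * (\<Prod>j<N. 1 - fps_X ^ c j) =
      (\<Prod>j<N. 1 - fps_X ^ (2 * c j) :: rat fps)" for N
  proof -
    have "((1 - fps_X ^ c j) oo (- fps_X)) * (1 - fps_X ^ c j) = (1 - fps_X ^ (2 * c j) :: rat fps)" for j
    proof -
      have "(1 - - x) * (1 - x) = 1 - x * x" for x :: "rat fps"
        by (simp add: algebra_simps)
      then show ?thesis
        by (simp only: uminus_X_compose_factor power_minus_odd[OF c(2)] mult_2 power_add)
    qed
    then show ?thesis
      by (simp add: fps_compose_prod_distrib flip: prod.distrib)
  qed
  ultimately have "(\<lambda>N. \<Prod>j<N. 1 - fps_X ^ (2 * c j)) \<longlonglongrightarrow> (euler c oo (- fps_X)) * euler c"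
    by simp
  then show ?thesis
    using euler_tendsto(1)[OF c2] by (rule LIMSEQ_unique)
qed

lemma odd_part:
  fixes F S :: "rat fps"
  assumes "\<And>m. S $ m = F $ (2 * m + 1)"
  shows "2 * fps_X * (S oo fps_X ^ 2) = F - (F oo (- fps_X))"
proof (rule fps_ext)
  fix k
  show "(2 * fps_X * (S oo fps_X ^ 2)) $ k = (F - (F oo (- fps_X))) $ k"
  proof (cases k)
    case 0
    then show ?thesis
      by (simp add: fps_compose_uminus' numeral_fps_const mult.assoc)
  next
    case (Suc l)
    have "(2 * fps_X * (S oo fps_X ^ 2)) $ k = 2 * (S oo fps_X ^ 2) $ l"
      unfolding Suc by (simp add: numeral_fps_const mult.assoc)
    also have "\<dots> = (F - (F oo (- fps_X))) $ k"
      unfolding Suc using assms[of "l div 2"]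
      by (cases "even l") (simp_all add: fps_nth_compose_X_power fps_compose_uminus')
    finally show ?thesis .
  qed
qed

theorem corollary6p17:
  fixes n :: nat
  assumes "n \<ge> 3"
  shows "fps_to_fls (string_function n oo fps_X ^ 2) =
           1 / (2 * fls_X) *
           (1 / (qfac 1 * qfac 2 ^ (n - 1) * qfac 4) - qfac 1 / qfac 2 ^ (n + 2))"
proof -
  \<comment> \<open>In terms of \<open>q = X\<^sup>2\<close>, the series \<open>E 1\<close>, \<open>E 2\<close>, \<open>E 4\<close> are \<open>(q\<^sup>1\<^sup>/\<^sup>2)\<^sub>\<infinity>\<close>, \<open>(q)\<^sub>\<infinity>\<close>, \<open>(q\<^sup>2)\<^sub>\<infinity>\<close>; \<open>\<sigma>\<close> substitutes \<open>-X\<close> for \<open>X\<close>.\<close>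
  define E where "E k = euler (\<lambda>j. k * Suc j)" for k
  define D where "D = euler (\<lambda>j. 2 * j + 1)"
  define \<sigma> where "\<sigma> f = f oo (- fps_X :: rat fps)" for f
  have qfac: "qfac k = fps_to_fls (E k)" for k
    by (simp add: qfac_def E_def euler_def)
  obtain F where F: "has_gf (admissible n) (total_weight n) F" "F * (E 2 * E 4 * D * E 2 ^ (n - 1)) = 1"
    using has_gf_admissible[OF assms] unfolding E_def D_def by blast
  have E1: "E 1 = D * E 2" and E2: "E 2 = euler (\<lambda>j. 2 * (2 * j + 1)) * E 4"
    using euler_dissect[of 1] euler_dissect[of 2] by (simp_all add: E_def D_def)
  have \<sigma>_mult: "\<sigma> (f * g) = \<sigma> f * \<sigma> g" for f g
    by (simp add: \<sigma>_def fps_compose_mult_distrib)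
  have \<sigma>_power: "\<sigma> (f ^ k) = \<sigma> f ^ k" for f k
    by (simp add: \<sigma>_def fps_compose_power)
  have \<sigma>_E: "\<sigma> (E 2) = E 2" "\<sigma> (E 4) = E 4"
    unfolding \<sigma>_def E_def by (rule euler_even_compose; simp)+
  \<comment> \<open>The only factor of \<open>F\<close> that changes under \<open>\<sigma>\<close> is \<open>D\<close>.\<close>
  have \<sigma>_D: "\<sigma> D * D * E 4 = E 2"
    using euler_odd_compose[of "\<lambda>j. 2 * j + 1"] by (simp add: E2 \<sigma>_def D_def)
  have "\<sigma> (F * (E 2 * E 4 * D * E 2 ^ (n - 1))) = \<sigma> 1"
    by (simp only: F(2))
  then have \<sigma>_F: "\<sigma> F * (E 2 * E 4 * \<sigma> D * E 2 ^ (n - 1)) = 1"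
    by (simp only: \<sigma>_mult \<sigma>_power \<sigma>_E) (simp add: \<sigma>_def)
  have pow: "E 2 ^ (n + 2) = E 2 * E 2 * E 2 * E 2 ^ (n - 1)"
  proof -
    have "n + 2 = Suc (Suc (Suc (n - 1)))"
      using assms by simp
    then show ?thesis
      by (simp only: power_Suc mult_ac)
  qed
  have first: "F * (E 1 * E 2 ^ (n - 1) * E 4) = 1"
    using F(2) unfolding E1 by (simp only: mult_ac)
  have "\<sigma> F * E 2 ^ (n + 2) = \<sigma> F * (E 2 * (\<sigma> D * D * E 4) * E 2 * E 2 ^ (n - 1))"
    unfolding \<sigma>_D pow by (simp only: mult_ac)
  also have "\<dots> = (\<sigma> F * (E 2 * E 4 * \<sigma> D * E 2 ^ (n - 1))) * (D * E 2)"
    by (simp only: mult_ac)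
  finally have second: "\<sigma> F * E 2 ^ (n + 2) = E 1"
    by (simp only: \<sigma>_F E1 mult_1_left)
  have E0: "E k \<noteq> 0" if "k > 0" for k
  proof -
    have "k * Suc j > j" for j
      using that by (cases k) auto
    then have "E k $ 0 = 1"
      unfolding E_def by (rule euler_tendsto(2))
    then show ?thesis
      by auto
  qed
  have "string_function n $ m = F $ (2 * m + 1)" for m
    using F(1) card_Z_Lambda1[OF assms, of m]
    by (simp add: string_function_def has_gf_def admissible_def conj_assoc)
  then have "2 * fps_X * (string_function n oo fps_X ^ 2) = F - \<sigma> F"
    unfolding \<sigma>_def by (rule odd_part)
  then have "fps_to_fls (2 * fps_X * (string_function n oo fps_X ^ 2)) = fps_to_fls (F - \<sigma> F)"
    by simp
  then have main: "2 * fls_X * fps_to_fls (string_function n oo fps_X ^ 2) = fps_to_fls F - fps_to_fls (\<sigma> F)"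
    by (simp add: fls_times_fps_to_fls)
  have nz: "qfac 1 \<noteq> 0" "qfac 2 \<noteq> 0" "qfac 4 \<noteq> 0"
    using E0[of 1] E0[of 2] E0[of 4] by (simp_all add: qfac)
  have "fps_to_fls (F * (E 1 * E 2 ^ (n - 1) * E 4)) = 1"
    by (simp only: first fps_one_to_fls)
  then have "fps_to_fls F * (qfac 1 * qfac 2 ^ (n - 1) * qfac 4) = 1"
    by (simp add: qfac fls_times_fps_to_fls fps_to_fls_power)
  then have 1: "fps_to_fls F = 1 / (qfac 1 * qfac 2 ^ (n - 1) * qfac 4)"
    using nz by (simp add: eq_divide_eq)
  have "fps_to_fls (\<sigma> F * E 2 ^ (n + 2)) = fps_to_fls (E 1)"
    by (simp only: second)
  then have "fps_to_fls (\<sigma> F) * qfac 2 ^ (n + 2) = qfac 1"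
    by (simp only: qfac fls_times_fps_to_fls fps_to_fls_power)
  then have 2: "fps_to_fls (\<sigma> F) = qfac 1 / qfac 2 ^ (n + 2)"
    using nz by (simp add: eq_divide_eq)
  have "fps_to_fls (string_function n oo fps_X ^ 2) = (fps_to_fls F - fps_to_fls (\<sigma> F)) / (2 * fls_X)"
    unfolding main[symmetric] by simp
  then show ?thesis
    unfolding 1 2 by simp
qed

end
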